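(* Non-Terminal Spanning Tree admits a kernel with at most $8\,\mathtt{vc}(G)+2$ vertices when parameterized by the vertex cover number: there is a polynomial-time algorithm that, given an instance $(G, V_{\rm NT})$, outputs an equivalent instance of Non-Terminal Spanning Tree whose graph has at most $8\,\mathtt{vc}(G)+2$ vertices, where $\mathtt{vc}(G)$ is the vertex cover number of $G$.
   Context: Non-Terminal Spanning Tree: given a connected undirected graph $G=(V,E)$ and a set $V_{\rm NT}\subseteq V$ with $|V_{\rm NT}| \le |V|-2$, decide whether $G$ has a spanning tree $T$ in which every vertex of $V_{\rm NT}$ has degree at least $2$. A vertex cover is a vertex set meeting every edge; $\mathtt{vc}(G)$ is the minimum size of a vertex cover of $G$. Two instances are equivalent if both are yes-instances or both are no-instances. *)

theory Defs
  imports "HOL-Computational_Algebra.Polynomial"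
begin

section \<open>Graphs, spanning trees and vertex covers\<close>

definition ugraph :: "'a set \<Rightarrow> 'a set set \<Rightarrow> bool" where
  "ugraph V E \<longleftrightarrow> finite V \<and> (\<forall>e\<in>E. e \<subseteq> V \<and> card e = 2)"

definition graph_connected :: "'a set \<Rightarrow> 'a set set \<Rightarrow> bool" where
  "graph_connected V E \<longleftrightarrow>
     V \<noteq> {} \<and> (\<forall>u\<in>V. \<forall>v\<in>V. (u, v) \<in> {(x, y). {x, y} \<in> E}\<^sup>*)"

definition graph_cycle :: "'a set set \<Rightarrow> 'a list \<Rightarrow> bool" where
  "graph_cycle E vs \<longleftrightarrow> 3 \<le> length vs \<and> distinct vs \<and>
     (\<forall>i<length vs. {vs ! i, vs ! (Suc i mod length vs)} \<in> E)"

text \<open>A spanning tree is identified with its edge set. (The library theory of digraphs has a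
  notion of spanning tree, but it forbids directed cycles only and so does not apply to
  undirected graphs.)\<close>

definition spanning_tree :: "'a set \<Rightarrow> 'a set set \<Rightarrow> 'a set set \<Rightarrow> bool" where
  "spanning_tree V E T \<longleftrightarrow> T \<subseteq> E \<and> graph_connected V T \<and> (\<nexists>vs. graph_cycle T vs)"

definition degree_in :: "'a set set \<Rightarrow> 'a \<Rightarrow> nat" where
  "degree_in E v = card {e \<in> E. v \<in> e}"

definition vertex_cover :: "'a set \<Rightarrow> 'a set set \<Rightarrow> 'a set \<Rightarrow> bool" where
  "vertex_cover V E C \<longleftrightarrow> C \<subseteq> V \<and> (\<forall>e\<in>E. e \<inter> C \<noteq> {})"

definition vc :: "'a set \<Rightarrow> 'a set set \<Rightarrow> nat" where
  "vc V E = (LEAST k. \<exists>C. vertex_cover V E C \<and> card C = k)"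


section \<open>Non-Terminal Spanning Tree\<close>

text \<open>The condition $|V_{NT}| \le |V| - 2$ is written without subtraction, which is truncated
  on natural numbers.\<close>

definition ntst_instance :: "'a set \<Rightarrow> 'a set set \<Rightarrow> 'a set \<Rightarrow> bool" where
  "ntst_instance V E NT \<longleftrightarrow>
     ugraph V E \<and> graph_connected V E \<and> NT \<subseteq> V \<and> card NT + 2 \<le> card V"

definition ntst_yes :: "'a set \<Rightarrow> 'a set set \<Rightarrow> 'a set \<Rightarrow> bool" where
  "ntst_yes V E NT \<longleftrightarrow> (\<exists>T. spanning_tree V E T \<and> (\<forall>v\<in>NT. 2 \<le> degree_in T v))"


section \<open>Machine model\<close>

text \<open>
  Algorithms are structured programs for a random access machine. The memory consists of named
  one-dimensional arrays of natural numbers with indirect addressing; a program mentions only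
  finitely many of them, so interleaving them gives the usual single memory. The arithmetic
  operations are addition and truncated subtraction. There is deliberately no multiplication:
  in \<open>t\<close> steps numbers then only gain \<open>O(t)\<close> bits, so that unit cost per
  assignment and per test (expressions have a size fixed by the program) defines the same
  polynomial-time class as Turing machines.
\<close>

type_synonym vname = string
type_synonym state = "vname \<Rightarrow> nat \<Rightarrow> nat"

datatype aexp = Const nat | Cell vname aexp | Plus aexp aexp | Monus aexp aexp

datatype bexp = Less aexp aexp | Not bexp | And bexp bexp

datatype com =
    Skip
  | Assign vname aexp aexp  \<comment> \<open>array, index, new value\<close>
  | Seq com com
  | If bexp com com
  | While bexp com

fun aval :: "aexp \<Rightarrow> state \<Rightarrow> nat" where
  "aval (Const k) s = k"
| "aval (Cell x a) s = s x (aval a s)"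
| "aval (Plus a b) s = aval a s + aval b s"
| "aval (Monus a b) s = aval a s - aval b s"

fun bval :: "bexp \<Rightarrow> state \<Rightarrow> bool" where
  "bval (Less a b) s \<longleftrightarrow> aval a s < aval b s"
| "bval (Not b) s \<longleftrightarrow> \<not> bval b s"
| "bval (And b c) s \<longleftrightarrow> bval b s \<and> bval c s"

definition update :: "state \<Rightarrow> vname \<Rightarrow> nat \<Rightarrow> nat \<Rightarrow> state" where
  "update s x i k = s(x := (s x)(i := k))"

text \<open>\<open>exec c s t s'\<close>: program \<open>c\<close> started in \<open>s\<close> halts in
  \<open>s'\<close> after exactly \<open>t\<close> steps.\<close>

inductive exec :: "com \<Rightarrow> state \<Rightarrow> nat \<Rightarrow> state \<Rightarrow> bool" where
  Skip: "exec Skip s 1 s"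
| Assign: "exec (Assign x a b) s 1 (update s x (aval a s) (aval b s))"
| Seq: "exec c1 s t1 s1 \<Longrightarrow> exec c2 s1 t2 s2 \<Longrightarrow> exec (Seq c1 c2) s (t1 + t2) s2"
| IfTrue: "bval b s \<Longrightarrow> exec c1 s t s1 \<Longrightarrow> exec (If b c1 c2) s (Suc t) s1"
| IfFalse: "\<not> bval b s \<Longrightarrow> exec c2 s t s1 \<Longrightarrow> exec (If b c1 c2) s (Suc t) s1"
| WhileFalse: "\<not> bval b s \<Longrightarrow> exec (While b c) s 1 s"
| WhileTrue: "bval b s \<Longrightarrow> exec c s t1 s1 \<Longrightarrow> exec (While b c) s1 t2 s2 \<Longrightarrow>
    exec (While b c) s (Suc (t1 + t2)) s2"

inductive_cases exec_SkipE: "exec Skip s t s'"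
inductive_cases exec_AssignE: "exec (Assign x a b) s t s'"
inductive_cases exec_SeqE: "exec (Seq c1 c2) s t s'"
inductive_cases exec_IfE: "exec (If b c1 c2) s t s'"
inductive_cases exec_WhileE: "exec (While b c) s t s'"

lemma exec_deterministic:
  "exec c s t s1 \<Longrightarrow> exec c s t' s2 \<Longrightarrow> t' = t \<and> s2 = s1"
proof (induction arbitrary: t' s2 rule: exec.induct)
  case Skip
  then show ?case by (auto elim: exec_SkipE)
next
  case Assign
  then show ?case by (auto elim: exec_AssignE)
next
  case (Seq c1 s t1 s1 c2 t2 s3)
  then show ?case by (blast elim: exec_SeqE)
next
  case IfTrue
  then show ?case by (blast elim: exec_IfE)
next
  case IfFalse
  then show ?case by (blast elim: exec_IfE)
next
  case (WhileFalse b s c)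
  from WhileFalse(2,1) show ?case by cases auto
next
  case (WhileTrue b s c u1 s1 u2 s3)
  from WhileTrue.prems WhileTrue.hyps(1) obtain v1 r v2
    where "t' = Suc (v1 + v2)" "exec c s v1 r" "exec (While b c) r v2 s2"
    by (blast elim: exec_WhileE)
  with WhileTrue.IH show ?case by blast
qed


section \<open>Input and output\<close>

text \<open>
  An instance on the vertices \<open>0, \<dots>, n - 1\<close> is given by \<open>n\<close>, the adjacency matrix
  stored row by row, and the characteristic vector of \<open>NT\<close>. All other memory is 0.
  If \<open>E\<close> is a set of edges on \<open>{..<n}\<close>, the array \<open>adj\<close> vanishes from
  index \<open>n * n\<close> on. The input has \<open>n * n + n + 1\<close> cells, so running times may be
  measured in terms of \<open>n\<close>.
\<close>

definition encode :: "nat \<Rightarrow> nat set set \<Rightarrow> nat set \<Rightarrow> state" where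
  "encode n E NT = (\<lambda>x i.
     if x = ''n'' then (if i = 0 then n else 0)
     else if x = ''adj'' then of_bool ({i div n, i mod n} \<in> E)
     else if x = ''nt'' then of_bool (i \<in> NT)
     else 0)"

text \<open>On output only the cells that carry the instance matter; the rest may hold scratch
  data.\<close>

definition represents :: "state \<Rightarrow> nat \<Rightarrow> nat set set \<Rightarrow> nat set \<Rightarrow> bool" where
  "represents s n E NT \<longleftrightarrow>
     s ''n'' 0 = n \<and>
     (\<forall>i<n * n. s ''adj'' i = encode n E NT ''adj'' i) \<and>
     (\<forall>i<n. s ''nt'' i = encode n E NT ''nt'' i)"

end

theory Submission
  imports Defs
begin

text \<open>
  A connected graph has the required spanning tree iff some forest in it gives every vertex of
  \<open>NT\<close> degree at least 2, since any forest extends to a spanning tree. Let \<open>X\<close> consist of the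
  end vertices of a greedy maximal matching, so that \<open>X\<close> is a vertex cover with at most
  \<open>2 * vc\<close> elements. In a yes-instance the edges at the vertices of \<open>NT - X\<close> form a forest, whence
  \<open>card (NT - X) < card X\<close>. The remaining vertices \<open>I\<close>, outside \<open>X\<close> and \<open>NT\<close>, bid in an auction for
  two copies of each of their neighbours in \<open>X\<close>: an unassigned vertex takes the cheapest copy, evicting
  its holder and raising its price by 1, unless all prices have reached a limit above \<open>2 * n\<close>. Each
  holder then has nearly the cheapest copy available to it. If some vertices remain unassigned, one
  of the prices from 1 to \<open>2 * n\<close> does not occur; the vertices of \<open>X\<close> priced above this gap
  form the head of a crown: each holds two private leaves, and neither these leaves nor the unassigned
  vertices have neighbours outside the head. A forest can therefore be rerouted to avoid all
  unassigned vertices, so merging these into a single vertex does not change the answer. At most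
  \<open>card X + (card X - 1) + 2 * card X + 1\<close> vertices are left in a yes-instance.
\<close>

section \<open>Forests\<close>

text \<open>Deleting the unassigned vertices could disconnect the graph, because they may be the
  only link between vertices of the head. Merging them keeps it connected, as an image of a
  connected graph, and costs a single vertex. Feasibility by forests ignores connectedness, so the
  argument may still pass through the graph without these vertices. A head vertex needs two private
  leaves to meet a degree demand of 2 by itself, hence two copies of each vertex. Crowns are usually
  extracted from maximum matchings; the auction replaces augmenting paths by single bids with a
  local invariant, and the sum of the prices serves as its potential. The final bound arises from
  the size test at 4 times the size of \<open>X\<close> plus 2, where \<open>X\<close> has at most
  twice the minimum size of a cover.\<close>

definition reach :: "'a set set \<Rightarrow> 'a \<Rightarrow> 'a \<Rightarrow> bool" where
  "reach F u v \<longleftrightarrow> (u, v) \<in> {(x, y). {x, y} \<in> F}\<^sup>*"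

definition forest :: "'a set set \<Rightarrow> bool" where
  "forest F \<longleftrightarrow> (\<nexists>vs. graph_cycle F vs)"

lemma reach_refl [simp]: "reach F u u"
  by (simp add: reach_def)

lemma reach_edge: "{u, v} \<in> F \<Longrightarrow> reach F u v"
  by (auto simp: reach_def)

lemma reach_trans: "reach F u v \<Longrightarrow> reach F v w \<Longrightarrow> reach F u w"
  by (simp add: reach_def)

lemma reach_sym: "reach F u v \<Longrightarrow> reach F v u"
proof -
  have "sym ({(x, y). {x, y} \<in> F}\<^sup>*)"
    by (intro sym_rtrancl) (auto simp: sym_def insert_commute)
  then show "reach F u v \<Longrightarrow> reach F v u"
    by (auto simp: reach_def dest: symD)
qed

lemma reach_mono: "F \<subseteq> G \<Longrightarrow> reach F u v \<Longrightarrow> reach G u v"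
  unfolding reach_def by (rule subsetD[OF rtrancl_mono]) auto

lemma reach_isolated:
  assumes "reach F u v" "\<And>e. e \<in> F \<Longrightarrow> u \<notin> e"
  shows "v = u"
  using assms(1) unfolding reach_def
  by (cases rule: converse_rtranclE) (use assms(2) in blast)+

text \<open>Walks are mapped edge by edge. The case \<open>f = id\<close> compares two edge sets on
  the same vertices; the general case carries connectedness over to a merged graph.\<close>

lemma reach_map:
  assumes "reach E u v" "\<And>x y. {x, y} \<in> E \<Longrightarrow> reach F (f x) (f y)"
  shows "reach F (f u) (f v)"
  using assms(1)[unfolded reach_def]
proof (induction rule: rtrancl_induct)
  case (step y z)
  then show ?case using assms(2)[of y z] by (auto intro: reach_trans)
qed simp

lemma graph_connected_reach:
  "graph_connected V E \<longleftrightarrow> V \<noteq> {} \<and> (\<forall>u\<in>V. \<forall>v\<in>V. reach E u v)"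
  by (simp add: graph_connected_def reach_def)

lemma graph_connected_image:
  assumes "graph_connected V E"
  shows "graph_connected (f ` V) ((`) f ` E)"
proof -
  have "reach ((`) f ` E) (f x) (f y)" if "{x, y} \<in> E" for x y
    by (rule reach_edge) (use imageI[OF that, of "(`) f"] in simp)
  then show ?thesis
    using assms reach_map[of E _ _ "(`) f ` E" f] by (simp add: graph_connected_reach)
qed

text \<open>Cycles are lists of distinct vertices, so walks have to be freed of repetitions: when
  the walk returns to a vertex of the path, the path is cut off there.\<close>

lemma reach_path:
  assumes "reach F u v"
  shows "\<exists>ps. ps \<noteq> [] \<and> hd ps = u \<and> last ps = v \<and> distinct ps \<and>
    (\<forall>i. Suc i < length ps \<longrightarrow> {ps ! i, ps ! Suc i} \<in> F)"
  using assms[unfolded reach_def]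
proof (induction rule: rtrancl_induct)
  case base
  show ?case by (rule exI[of _ "[u]"]) simp
next
  case (step y z)
  then obtain ps where ps: "ps \<noteq> []" "hd ps = u" "last ps = y" "distinct ps"
    "\<And>i. Suc i < length ps \<Longrightarrow> {ps ! i, ps ! Suc i} \<in> F" by auto
  show ?case
  proof (cases "z \<in> set ps")
    case True
    then obtain k where k: "k < length ps" "ps ! k = z" by (auto simp: in_set_conv_nth)
    show ?thesis
    proof (intro exI[of _ "take (Suc k) ps"] conjI allI impI)
      show "last (take (Suc k) ps) = z" using k by (simp add: take_Suc_conv_app_nth)
    qed (use ps k in \<open>auto simp: hd_conv_nth\<close>)
  next
    case False
    have e: "{last ps, z} \<in> F" using step.hyps ps(3) by simp
    have "{(ps @ [z]) ! i, (ps @ [z]) ! Suc i} \<in> F" if "Suc i < length (ps @ [z])" for i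
    proof (cases "Suc i < length ps")
      case True
      then show ?thesis using ps(5)[of i] by (simp add: nth_append)
    next
      case False
      then have "i = length ps - 1" using that by simp
      then show ?thesis using e ps(1) by (auto simp: nth_append last_conv_nth)
    qed
    then show ?thesis
      using ps False by (intro exI[of _ "ps @ [z]"]) auto
  qed
qed

section \<open>Acyclic edge sets and spanning trees\<close>

lemma forest_subset: "forest F \<Longrightarrow> G \<subseteq> F \<Longrightarrow> forest G"
  unfolding forest_def graph_cycle_def by blast

lemma forest_empty [simp]: "forest {}"
proof -
  have "\<not> graph_cycle {} vs" for vs :: "'a list"
    by (cases vs) (auto simp: graph_cycle_def)
  then show ?thesis by (simp add: forest_def)
qed

text \<open>A cycle without one of its edges is a path: from the far end of \<open>e\<close> the
  remaining \<open>length vs - 1\<close> steps lead around to its near end.\<close>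

lemma reach_around:
  assumes cyc: "graph_cycle (insert e F) vs" and i: "i < length vs"
    and e: "e = {vs ! i, vs ! (Suc i mod length vs)}"
  shows "reach F (vs ! (Suc i mod length vs)) (vs ! i)"
proof -
  define m where "m = length vs"
  have m: "3 \<le> m" and dist: "distinct vs" using cyc by (auto simp: graph_cycle_def m_def)
  have other: "{vs ! j, vs ! (Suc j mod m)} \<in> F" if j: "j < m" "j \<noteq> i" for j
  proof -
    have "{vs ! j, vs ! (Suc j mod m)} \<in> insert e F"
      using cyc j by (auto simp: graph_cycle_def m_def)
    \<comment> \<open>Equal edges at different positions would be traversed in opposite directions,
      so \<open>i\<close> and \<open>j\<close> would be successors of each other, which a cycle of
      length at least 3 excludes.\<close>
    moreover have "{vs ! j, vs ! (Suc j mod m)} \<noteq> e"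
    proof
      assume "{vs ! j, vs ! (Suc j mod m)} = e"
      then have "vs ! j = vs ! (Suc i mod m) \<and> vs ! (Suc j mod m) = vs ! i"
        using e j i dist by (auto simp: doubleton_eq_iff nth_eq_iff_index_eq m_def)
      moreover have "Suc i mod m < length vs" "Suc j mod m < length vs"
        using m by (simp_all add: m_def[symmetric])
      ultimately have "j = Suc i mod m" "Suc j mod m = i"
        using j i dist nth_eq_iff_index_eq[OF dist] by (auto simp: m_def)
      then show False using m i
        by (cases "Suc i = m"; cases "Suc j = m") (auto simp: m_def)
    qed
    ultimately show ?thesis by simp
  qed
  have "reach F (vs ! (Suc i mod m)) (vs ! ((Suc i + k) mod m))" if "k < m" for k
    using that
  proof (induction k)
    case (Suc k)
    have "(Suc i + k) mod m \<noteq> i"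
    proof
      assume "(Suc i + k) mod m = i"
      moreover have "(Suc i + k) mod m = (if Suc i + k < m then Suc i + k else Suc i + k - m)"
        using i Suc.prems by (cases "Suc i + k < m") (simp_all add: m_def le_mod_geq)
      ultimately show False using Suc.prems i by (auto simp: m_def split: if_splits)
    qed
    then have "{vs ! ((Suc i + k) mod m), vs ! (Suc ((Suc i + k) mod m) mod m)} \<in> F"
      using other[of "(Suc i + k) mod m"] m by simp
    then show ?case using Suc by (auto simp: mod_Suc_eq intro: reach_trans reach_edge)
  qed simp
  moreover have "Suc i + (m - 1) = i + m" using m by simp
  then have "(Suc i + (m - 1)) mod m = i" using i by (simp add: m_def)
  ultimately show ?thesis using m by (metis Suc_le_eq diff_less less_numeral_extra(1) m_def
        numeral_3_eq_3 order_less_trans zero_less_Suc)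
qed

text \<open>A new cycle has to pass through the new edge, and the rest of it joins the ends of that
  edge within \<open>F\<close>.\<close>

lemma forest_insert:
  assumes "forest F" "\<not> reach F u v"
  shows "forest (insert {u, v} F)"
  unfolding forest_def
proof
  assume "\<exists>vs. graph_cycle (insert {u, v} F) vs"
  then obtain vs where vs: "graph_cycle (insert {u, v} F) vs" by blast
  moreover have "\<not> graph_cycle F vs" using assms(1) by (simp add: forest_def)
  ultimately obtain i where i: "i < length vs"
    and ni: "{vs ! i, vs ! (Suc i mod length vs)} \<notin> F"
    unfolding graph_cycle_def by auto
  with vs have e: "{u, v} = {vs ! i, vs ! (Suc i mod length vs)}"
    by (auto simp: graph_cycle_def)
  from reach_around[OF vs i e] e have "reach F u v"
    by (auto simp: doubleton_eq_iff intro: reach_sym)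
  with assms(2) show False by simp
qed

lemma forest_insertD:
  assumes "forest (insert {u, v} F)" "{u, v} \<notin> F" "u \<noteq> v"
  shows "\<not> reach F u v"
proof
  assume "reach F u v"
  then obtain ps where ps: "ps \<noteq> []" "hd ps = u" "last ps = v" "distinct ps"
    "\<And>i. Suc i < length ps \<Longrightarrow> {ps ! i, ps ! Suc i} \<in> F"
    using reach_path by metis
  \<comment> \<open>Only lists of length at least 3 count as cycles; lengths 1 and 2 are excluded by
    \<open>u \<noteq> v\<close> and by the absence of the new edge from \<open>F\<close>.\<close>
  have 1: "length ps \<noteq> 1"
    using ps assms(3) by (auto simp: length_Suc_conv)
  have 2: "length ps \<noteq> 2"
  proof
    assume "length ps = 2"
    then obtain a b where "ps = [a, b]" by (auto simp: length_Suc_conv numeral_2_eq_2)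
    with ps(2,3) ps(5)[of 0] assms(2) show False by simp
  qed
  have 3: "3 \<le> length ps"
    using 1 2 ps(1) by (cases "length ps") auto
  have "{ps ! i, ps ! (Suc i mod length ps)} \<in> insert {u, v} F" if "i < length ps" for i
  proof (cases "Suc i = length ps")
    case True
    then have "i = length ps - 1" by simp
    then show ?thesis using ps(1-3) True
      by (auto simp: hd_conv_nth last_conv_nth insert_commute)
  next
    case False
    then show ?thesis using ps(5)[of i] that by simp
  qed
  then have "graph_cycle (insert {u, v} F) ps"
    using ps(4) 3 by (simp add: graph_cycle_def)
  then show False using assms(1) by (simp add: forest_def)
qed

lemma ugraph_finite_edges: "ugraph V E \<Longrightarrow> finite E"
  by (auto simp: ugraph_def intro: finite_subset[of _ "Pow V"])

text \<open>A maximal forest between \<open>F\<close> and \<open>E\<close> works: an edge of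
  \<open>E\<close> between vertices that it does not connect could be added without closing a
  cycle.\<close>

lemma forest_spanning_tree:
  assumes "ugraph V E" "graph_connected V E" "F \<subseteq> E" "forest F"
  shows "\<exists>T. spanning_tree V E T \<and> F \<subseteq> T"
proof -
  let ?A = "{T. T \<subseteq> E \<and> F \<subseteq> T \<and> forest T}"
  have "finite ?A"
    using ugraph_finite_edges[OF assms(1)] by (intro finite_subset[of ?A "Pow E"]) auto
  moreover have "?A \<noteq> {}" using assms(3,4) by auto
  ultimately have "\<exists>T\<in>?A. \<forall>T'\<in>?A. T \<subseteq> T' \<longrightarrow> T = T'" by (rule finite_has_maximal)
  then obtain T where "T \<in> ?A" and max: "\<forall>T'\<in>?A. T \<subseteq> T' \<longrightarrow> T = T'" by (rule bexE)
  then have T: "T \<subseteq> E" "F \<subseteq> T" "forest T" by simp_all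
  have "reach T x y" if "{x, y} \<in> E" for x y
  proof (rule ccontr)
    assume n: "\<not> reach T x y"
    have "insert {x, y} T \<in> ?A" using T that forest_insert[OF T(3) n] by auto
    from bspec[OF max this] have "T = insert {x, y} T" by (rule mp) (rule subset_insertI)
    then have "insert {x, y} T \<subseteq> T" by (rule equalityD2)
    then have "{x, y} \<in> T" by simp
    then show False using n reach_edge[of x y T] by simp
  qed
  then have "graph_connected V T"
    using assms(2) reach_map[of E _ _ T id] by (auto simp: graph_connected_reach)
  then show ?thesis using T by (auto simp: spanning_tree_def forest_def)
qed

lemma degree_in_mono: "finite G \<Longrightarrow> F \<subseteq> G \<Longrightarrow> degree_in F v \<le> degree_in G v"
  unfolding degree_in_def by (intro card_mono) auto

definition forest_feasible :: "'a set set \<Rightarrow> 'a set \<Rightarrow> bool" where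
  "forest_feasible E NT \<longleftrightarrow> (\<exists>F \<subseteq> E. forest F \<and> (\<forall>v\<in>NT. 2 \<le> degree_in F v))"

lemma ntst_yes_iff_forest_feasible:
  assumes "ugraph V E" "graph_connected V E"
  shows "ntst_yes V E NT \<longleftrightarrow> forest_feasible E NT"
proof
  assume "forest_feasible E NT"
  then obtain F where F: "F \<subseteq> E" "forest F" "\<And>v. v \<in> NT \<Longrightarrow> 2 \<le> degree_in F v"
    by (auto simp: forest_feasible_def)
  obtain T where T: "spanning_tree V E T" "F \<subseteq> T"
    using forest_spanning_tree[OF assms F(1,2)] by blast
  have "finite T"
    using T(1) ugraph_finite_edges[OF assms(1)] by (auto simp: spanning_tree_def intro: finite_subset)
  have "2 \<le> degree_in T v" if "v \<in> NT" for v
    using F(3)[OF that] degree_in_mono[OF \<open>finite T\<close> T(2), of v] by simp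
  then show "ntst_yes V E NT" using T(1) by (auto simp: ntst_yes_def)
qed (auto simp: ntst_yes_def forest_feasible_def spanning_tree_def forest_def)

text \<open>Each added edge merges two components. These are tracked by a colouring \<open>c\<close>
  in which equally coloured vertices are connected: every edge costs exactly one colour, and at
  least one colour is left.\<close>

lemma forest_card:
  assumes "finite V" "V \<noteq> {}" "ugraph V F" "forest F"
  shows "card F < card V"
proof -
  have "\<exists>c :: 'a \<Rightarrow> 'a. (\<forall>u\<in>V. \<forall>v\<in>V. c u = c v \<longrightarrow> reach F u v) \<and> card (c ` V) + card F = card V"
    if "finite F" "forest F" "ugraph V F"
    using that
  proof (induction F)
    case empty
    show ?case by (intro exI[of _ id]) simp
  next
    case (insert e F)
    have "forest F" "ugraph V F"
      using insert.prems forest_subset by (auto simp: ugraph_def)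
    with insert.IH obtain c :: "'a \<Rightarrow> 'a" where
      c: "\<And>u v. u \<in> V \<Longrightarrow> v \<in> V \<Longrightarrow> c u = c v \<Longrightarrow> reach F u v" and cc: "card (c ` V) + card F = card V"
      by auto
    obtain x y where e: "e = {x, y}" "x \<noteq> y" "x \<in> V" "y \<in> V"
      using insert.prems(2) by (auto simp: ugraph_def card_2_iff)
    \<comment> \<open>Otherwise \<open>x\<close> and \<open>y\<close> would be connected already and
      the new edge would close a cycle.\<close>
    have "c x \<noteq> c y"
      using forest_insertD[of x y F] insert e c by auto
    define c' where "c' = (\<lambda>z. if c z = c y then c x else c z)"
    have "c' ` V = c ` V - {c y}"
      using e \<open>c x \<noteq> c y\<close> by (force simp: c'_def)
    then have card: "Suc (card (c' ` V)) = card (c ` V)"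
      using assms(1) e card_Suc_Diff1[of "c ` V" "c y"] by auto
    have old: "reach (insert e F) u v" if "u \<in> V" "v \<in> V" "c u = c v" for u v
      using c[OF that] reach_mono[of F "insert e F"] by blast
    have xy: "reach (insert e F) x y" "reach (insert e F) y x"
      using e reach_edge[of x y "insert e F"] reach_sym by auto
    have "reach (insert e F) u v" if "u \<in> V" "v \<in> V" "c' u = c' v" for u v
      using that e xy old[of u v] old[of u y] old[of u x] old[of x v] old[of y v]
      by (auto simp: c'_def split: if_splits intro: reach_trans)
    then show ?case using cc card insert.hyps by (intro exI[of _ c']) auto
  qed
  then obtain c :: "'a \<Rightarrow> 'a" where "card (c ` V) + card F = card V"
    using assms ugraph_finite_edges by blast
  moreover have "card (c ` V) > 0" using assms by (simp add: card_gt_0_iff)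
  ultimately show ?thesis by simp
qed

text \<open>Double counting: the edges at \<open>I\<close> are at least \<open>2 * card I\<close> many and form a forest
  on \<open>I \<union> X\<close>.\<close>

lemma forest_independent_side:
  assumes "finite I" "finite X" "X \<noteq> {}" "forest F"
    and edges: "\<And>e. e \<in> F \<Longrightarrow> e \<inter> I \<noteq> {} \<Longrightarrow> \<exists>i\<in>I. \<exists>x\<in>X. e = {i, x}"
    and "I \<inter> X = {}" and deg: "\<And>i. i \<in> I \<Longrightarrow> 2 \<le> degree_in F i"
  shows "card I < card X"
proof -
  define S where "S = (\<lambda>i. {e \<in> F. i \<in> e})"
  define F' where "F' = (\<Union>i\<in>I. S i)"
  have inF: "\<exists>i\<in>I. \<exists>x\<in>X. e = {i, x}" if "e \<in> F'" for e
    using that edges[of e] by (auto simp: F'_def S_def)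
  have "e \<subseteq> I \<union> X \<and> card e = 2" if "e \<in> F'" for e
  proof -
    obtain i x where ix: "i \<in> I" "x \<in> X" "e = {i, x}" using inF \<open>e \<in> F'\<close> by meson
    then have "i \<noteq> x" using \<open>I \<inter> X = {}\<close> by blast
    then show ?thesis using ix by simp
  qed
  then have ug: "ugraph (I \<union> X) F'"
    using assms(1,2) by (simp add: ugraph_def)
  then have fin: "finite F'" by (rule ugraph_finite_edges)
  have finS: "finite (S i)" if "i \<in> I" for i
    by (rule finite_subset[OF _ fin]) (use that in \<open>auto simp: F'_def\<close>)
  \<comment> \<open>An edge at \<open>I\<close> has its other end in \<open>X\<close>, so no edge is
    counted at two vertices of \<open>I\<close>.\<close>
  have disj: "S i \<inter> S j = {}" if ij: "i \<in> I" "j \<in> I" "i \<noteq> j" for i j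
  proof (rule ccontr)
    assume "S i \<inter> S j \<noteq> {}"
    then obtain e where e: "e \<in> F" "i \<in> e" "j \<in> e" by (auto simp: S_def)
    then obtain k x where "k \<in> I" "x \<in> X" "e = {k, x}" using edges[of e] ij(1) by blast
    then show False using e ij \<open>I \<inter> X = {}\<close> by auto
  qed
  have "2 * card I = (\<Sum>i\<in>I. 2)" by simp
  also have "\<dots> \<le> (\<Sum>i\<in>I. card (S i))"
    using deg by (intro sum_mono) (simp add: degree_in_def S_def)
  also have "\<dots> = card F'"
    unfolding F'_def using assms(1) finS disj by (intro card_UN_disjoint[symmetric]) auto
  also have "\<dots> < card (I \<union> X)"
    using forest_card[OF _ _ ug] assms(1-4) forest_subset[of F F'] by (auto simp: F'_def S_def)
  also have "\<dots> = card I + card X"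
    using assms by (intro card_Un_disjoint) auto
  finally show ?thesis by simp
qed

section \<open>Crowns\<close>

text \<open>A leaf that is not yet attached lies on no edge, so attaching it closes no cycle. That
  \<open>h l\<close> is outside \<open>L\<close> keeps leaves from being attached to one
  another.\<close>

lemma forest_pendant:
  assumes "finite L" "forest F" "\<And>e. e \<in> F \<Longrightarrow> e \<inter> L = {}" "\<And>l. l \<in> L \<Longrightarrow> h l \<notin> L"
  shows "forest (F \<union> (\<lambda>l. {h l, l}) ` L)"
  using assms
proof (induction L)
  case (insert l L)
  let ?F = "F \<union> (\<lambda>l. {h l, l}) ` L"
  have F: "forest ?F" using insert by auto
  have "l \<notin> e" if "e \<in> ?F" for e
    using that insert by auto
  then have "\<not> reach ?F l (h l)"
    using reach_isolated[of ?F l "h l"] insert.prems(3)[of l] by auto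
  then have "\<not> reach ?F (h l) l" using reach_sym[of ?F "h l" l] by argo
  from forest_insert[OF F this] show ?case by simp
qed simp

text \<open>Every vertex of the head \<open>R\<close> has the two private leaves \<open>l0\<close> and \<open>l1\<close>, which like the
  vertices of \<open>U\<close> have no neighbours outside \<open>R\<close>. Hence a forest may be modified to use
  the leaves and to avoid \<open>U\<close>.\<close>

lemma forest_feasible_crown:
  fixes R U NT :: "'a set" and l0 l1 :: "'a \<Rightarrow> 'a" and E :: "'a set set"
  defines "L \<equiv> l0 ` R \<union> l1 ` R"
  assumes E: "ugraph V E"
    and edge: "\<And>x. x \<in> R \<Longrightarrow> {x, l0 x} \<in> E \<and> {x, l1 x} \<in> E"
    and inj: "inj_on l0 R" "inj_on l1 R" "l0 ` R \<inter> l1 ` R = {}"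
    and nbhd: "\<And>u v. u \<in> L \<union> U \<Longrightarrow> {u, v} \<in> E \<Longrightarrow> v \<in> R"
    and disj: "R \<inter> (L \<union> U) = {}" "L \<inter> U = {}" "NT \<inter> (L \<union> U) = {}"
  shows "forest_feasible E NT \<longleftrightarrow> forest_feasible {e \<in> E. e \<inter> U = {}} NT"
proof
  assume "forest_feasible E NT"
  then obtain F where F: "F \<subseteq> E" "forest F" "\<And>v. v \<in> NT \<Longrightarrow> 2 \<le> degree_in F v"
    by (auto simp: forest_feasible_def)
  have finE: "finite E" and finV: "finite V" using E ugraph_finite_edges by (auto simp: ugraph_def)
  have "x \<in> V" if "x \<in> R" for x using edge[OF that] E by (auto simp: ugraph_def)
  then have "R \<subseteq> V" by blast
  then have finR: "finite R" using finV finite_subset by blast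
  \<comment> \<open>\<open>h\<close> takes a leaf back to its head vertex; no two head vertices
    share a leaf.\<close>
  define h where "h = (\<lambda>l. if l \<in> l0 ` R then inv_into R l0 l else inv_into R l1 l)"
  have h0: "h (l0 x) = x" if "x \<in> R" for x using that inj by (simp add: h_def)
  have h1: "h (l1 x) = x" if "x \<in> R" for x
    using that inj by (auto simp: h_def)
  \<comment> \<open>All edges at leaves and at \<open>U\<close> are given up, and in return every
    head vertex receives both of its leaf edges.\<close>
  define F1 where "F1 = {e \<in> F. e \<inter> (L \<union> U) = {}}"
  define F' where "F' = F1 \<union> (\<lambda>l. {h l, l}) ` L"
  have pend: "(\<lambda>l. {h l, l}) ` L = (\<lambda>x. {x, l0 x}) ` R \<union> (\<lambda>x. {x, l1 x}) ` R"
    by (simp add: L_def image_Un image_image h0 h1 cong: image_cong_simp)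
  have "forest F'" unfolding F'_def
  proof (rule forest_pendant)
    show "finite L" using finR by (simp add: L_def)
    show "forest F1" using F(2) by (rule forest_subset) (auto simp: F1_def)
    show "h l \<notin> L" if "l \<in> L" for l
      using that h0 h1 disj by (auto simp: L_def)
  qed (auto simp: F1_def)
  moreover have sub: "F' \<subseteq> {e \<in> E. e \<inter> U = {}}"
    using F(1) edge disj by (auto simp: F'_def F1_def L_def h0 h1)
  moreover have "2 \<le> degree_in F' v" if v: "v \<in> NT" for v
  proof -
    have fin: "finite F'" using sub finE by (auto intro: finite_subset)
    show ?thesis
    proof (cases "v \<in> R")
      case True
      have "l0 v \<noteq> l1 v" using inj(3) True by auto
      moreover have "{{v, l0 v}, {v, l1 v}} \<subseteq> {e \<in> F'. v \<in> e}"
        using True by (simp add: F'_def pend)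
      then have "card {{v, l0 v}, {v, l1 v}} \<le> degree_in F' v"
        unfolding degree_in_def using fin by (intro card_mono) auto
      moreover have "{v, l0 v} \<noteq> {v, l1 v}"
        using \<open>l0 v \<noteq> l1 v\<close> by (auto simp: doubleton_eq_iff)
      ultimately show ?thesis by simp
    next
      case False
      \<comment> \<open>Outside the head nothing is lost: a neighbour in \<open>L\<close> or
        \<open>U\<close> would put \<open>v\<close> into \<open>R\<close>.\<close>
      have "{e \<in> F. v \<in> e} \<subseteq> {e \<in> F'. v \<in> e}"
      proof safe
        fix e assume e: "e \<in> F" "v \<in> e"
        then have "card e = 2" using F(1) E by (auto simp: ugraph_def)
        with e(2) obtain w where w: "e = {w, v}" by (auto simp: card_2_iff)
        have "w \<notin> L \<union> U" using nbhd[of w v] e(1) F(1) w False by auto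
        moreover have "v \<notin> L \<union> U" using v disj by auto
        ultimately show "e \<in> F'" using e w by (auto simp: F'_def F1_def)
      qed
      then have "degree_in F v \<le> degree_in F' v"
        unfolding degree_in_def using fin by (intro card_mono) auto
      then show ?thesis using F(3)[OF v] by simp
    qed
  qed
  ultimately show "forest_feasible {e \<in> E. e \<inter> U = {}} NT"
    by (auto simp: forest_feasible_def)
qed (auto simp: forest_feasible_def)

section \<open>Renaming of vertices\<close>

lemma graph_cycle_image:
  assumes "inj_on f A" "\<Union>F \<subseteq> A" "graph_cycle F vs"
  shows "graph_cycle ((`) f ` F) (map f vs)"
proof -
  have e: "{vs ! i, vs ! (Suc i mod length vs)} \<in> F" if "i < length vs" for i
    using assms(3) that by (simp add: graph_cycle_def)
  have "vs ! i \<in> A" if "i < length vs" for i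
    using e[OF that] assms(2) by (auto simp only: Union_iff)
  then have "set vs \<subseteq> A" by (auto simp: in_set_conv_nth)
  then have "distinct (map f vs)"
    using assms by (auto simp: graph_cycle_def distinct_map intro: inj_on_subset)
  moreover have "{map f vs ! i, map f vs ! (Suc i mod length vs)} \<in> (`) f ` F" if "i < length vs" for i
  proof (rule image_eqI[OF _ e[OF that]])
    have "Suc i mod length vs < length vs" using that by (intro mod_less_divisor) auto
    with that show "{map f vs ! i, map f vs ! (Suc i mod length vs)} =
        f ` {vs ! i, vs ! (Suc i mod length vs)}" by simp
  qed
  ultimately show ?thesis using assms(3) by (simp add: graph_cycle_def)
qed

text \<open>A cycle in the image would be carried back to a cycle of \<open>F\<close> by the inverse
  \<open>g\<close> of \<open>f\<close> on \<open>A\<close>. Degrees do not drop because distinct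
  edges have distinct images.\<close>

lemma forest_feasible_image_le:
  assumes f: "inj_on f A" "\<Union>E \<subseteq> A" "NT \<subseteq> A" "finite A" and feas: "forest_feasible E NT"
  shows "forest_feasible ((`) f ` E) (f ` NT)"
proof -
  obtain F where F: "F \<subseteq> E" "forest F" "\<And>v. v \<in> NT \<Longrightarrow> 2 \<le> degree_in F v"
    using feas by (auto simp: forest_feasible_def)
  have FA: "\<Union>F \<subseteq> A" using F(1) f(2) by blast
  define g where "g = inv_into A f"
  have gf: "g ` f ` e = e" if "e \<in> F" for e
    using that FA f(1) by (force simp: g_def image_image)
  have "inj_on g (f ` A)" using f(1) by (auto simp: g_def inj_on_def)
  moreover have "\<Union>((`) f ` F) \<subseteq> f ` A" using FA by auto
  moreover have "(`) g ` (`) f ` F = F" using gf by (simp add: image_image)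
  ultimately have "forest ((`) f ` F)"
    using F(2) graph_cycle_image[of g "f ` A" "(`) f ` F"] by (auto simp: forest_def)
  moreover have "2 \<le> degree_in ((`) f ` F) (f v)" if v: "v \<in> NT" for v
  proof -
    have "finite F" using FA f(4) by (auto intro: finite_subset[of _ "Pow A"])
    have "inj_on ((`) f) {e \<in> F. v \<in> e}"
      by (rule inj_onI) (metis gf mem_Collect_eq)
    then have "degree_in F v = card ((`) f ` {e \<in> F. v \<in> e})"
      by (simp add: degree_in_def card_image)
    also have "\<dots> \<le> degree_in ((`) f ` F) (f v)"
      unfolding degree_in_def using \<open>finite F\<close> by (intro card_mono) auto
    finally show ?thesis using F(3)[OF v] by simp
  qed
  moreover have "(`) f ` F \<subseteq> (`) f ` E" using F(1) by (rule image_mono)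
  ultimately show ?thesis unfolding forest_feasible_def by blast
qed

lemma forest_feasible_image:
  assumes f: "inj_on f A" "\<Union>E \<subseteq> A" "NT \<subseteq> A" "finite A"
  shows "forest_feasible ((`) f ` E) (f ` NT) \<longleftrightarrow> forest_feasible E NT"
proof
  define g where "g = inv_into A f"
  have gf: "g ` f ` e = e" if "e \<subseteq> A" for e
    using that f(1) by (force simp: g_def image_image)
  assume "forest_feasible ((`) f ` E) (f ` NT)"
  then have "forest_feasible ((`) g ` (`) f ` E) (g ` f ` NT)"
    by (rule forest_feasible_image_le[of g "f ` A", rotated -1])
      (use f in \<open>auto simp: g_def inj_on_def\<close>)
  moreover have "(`) g ` (`) f ` E = E"
  proof -
    have "g ` f ` e = e" if "e \<in> E" for e using gf[of e] that f(2) by blast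
    then show ?thesis by (simp add: image_image)
  qed
  ultimately show "forest_feasible E NT" using gf[OF f(3)] by simp
qed (rule forest_feasible_image_le[OF f])

section \<open>Bounded programs\<close>

text \<open>Programs whose only loops are \<open>For\<close> loops: \<open>For i b p\<close> runs \<open>p\<close> with
  the cell 0 of \<open>i\<close> ranging over the numbers below the content of cell 0 of \<open>b\<close>.\<close>

datatype prog =
    Nop
  | Set vname aexp aexp
  | Then prog prog (infixr ";;" 60)
  | Cond bexp prog prog
  | For vname vname prog

abbreviation Var :: "vname \<Rightarrow> aexp" where
  "Var x \<equiv> Cell x (Const 0)"

fun code :: "prog \<Rightarrow> com" where
  "code Nop = Skip"
| "code (Set x a b) = Assign x a b"
| "code (p ;; q) = Seq (code p) (code q)"
| "code (Cond b p q) = If b (code p) (code q)"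
| "code (For i b p) = Seq (Assign i (Const 0) (Const 0))
    (While (Less (Var i) (Var b)) (Seq (code p) (Assign i (Const 0) (Plus (Var i) (Const 1)))))"

text \<open>The number of iterations is read once on entry, whereas the loop of \<open>code\<close>
  reads it before every test. The two agree under the hypotheses of \<open>exec_code\<close>, which
  forbid writing to a limit.\<close>

fun run :: "prog \<Rightarrow> state \<Rightarrow> state" where
  "run Nop s = s"
| "run (Set x a b) s = update s x (aval a s) (aval b s)"
| "run (p ;; q) s = run q (run p s)"
| "run (Cond b p q) s = (if bval b s then run p s else run q s)"
| "run (For i b p) s =
    ((\<lambda>t. update (run p t) i 0 (Suc (run p t i 0))) ^^ s b 0) (update s i 0 0)"

fun writes :: "prog \<Rightarrow> vname set" where
  "writes Nop = {}"
| "writes (Set x a b) = {x}"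
| "writes (p ;; q) = writes p \<union> writes q"
| "writes (Cond b p q) = writes p \<union> writes q"
| "writes (For i b p) = insert i (writes p)"

fun limits :: "prog \<Rightarrow> vname set" where
  "limits Nop = {}"
| "limits (Set x a b) = {}"
| "limits (p ;; q) = limits p \<union> limits q"
| "limits (Cond b p q) = limits p \<union> limits q"
| "limits (For i b p) = insert b (limits p)"

fun fresh_loops :: "prog \<Rightarrow> bool" where
  "fresh_loops Nop \<longleftrightarrow> True"
| "fresh_loops (Set x a b) \<longleftrightarrow> True"
| "fresh_loops (p ;; q) \<longleftrightarrow> fresh_loops p \<and> fresh_loops q"
| "fresh_loops (Cond b p q) \<longleftrightarrow> fresh_loops p \<and> fresh_loops q"
| "fresh_loops (For i b p) \<longleftrightarrow> i \<notin> writes p \<and> fresh_loops p"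

text \<open>The variable of the polynomial stands for a common bound on all limits. An iteration
  costs its body, one test and one increment; the initial assignment and the final test account for
  the other 2. A conditional is charged for both branches, which avoids a maximum.\<close>

fun cost :: "prog \<Rightarrow> nat poly" where
  "cost Nop = [:1:]"
| "cost (Set x a b) = [:1:]"
| "cost (p ;; q) = cost p + cost q"
| "cost (Cond b p q) = 1 + cost p + cost q"
| "cost (For i b p) = 2 + [:0, 1:] * (2 + cost p)"

lemma update_row [simp]: "update s x i k y = (if y = x then (s y)(i := k) else s y)"
  by (simp add: update_def)

lemma update_other: "y \<noteq> x \<Longrightarrow> update s x i k y = s y"
  by (simp add: update_def)

lemma funpow_invariant:
  assumes "I 0 s" "\<And>k t. k < N \<Longrightarrow> I k t \<Longrightarrow> I (Suc k) (f t)"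
  shows "I N ((f ^^ N) s)"
proof -
  have "k \<le> N \<Longrightarrow> I k ((f ^^ k) s)" for k
    by (induction k) (use assms in auto)
  then show ?thesis by simp
qed

lemma run_unwritten: "x \<notin> writes p \<Longrightarrow> run p s x = s x"
proof (induction p arbitrary: s)
  case (For i b p)
  show ?case
    unfolding run.simps
    by (rule funpow_invariant[where I = "\<lambda>_ t. t x = s x"]) (use For in \<open>auto simp: update_other\<close>)
qed (auto simp: update_other)

text \<open>As no limit is ever written, the bound \<open>M\<close> holds before every subprogram,
  and the costs add up.\<close>

lemma exec_code:
  assumes "fresh_loops p" "writes p \<inter> limits p = {}" "\<And>b. b \<in> limits p \<Longrightarrow> s b 0 \<le> M"
  shows "\<exists>t. exec (code p) s t (run p s) \<and> t \<le> poly (cost p) M"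
  using assms
proof (induction p arbitrary: s)
  case Nop
  then show ?case by (auto intro: exec.intros)
next
  case (Set x a b)
  then show ?case using exec.Assign[of x a b s] by (intro exI[of _ 1]) (simp del: update_row)
next
  case (Then p q)
  obtain t where t: "exec (code p) s t (run p s)" "t \<le> poly (cost p) M"
    using Then.IH(1)[of s] Then.prems by auto
  have "run p s b = s b" if "b \<in> limits q" for b
    using that Then.prems(2) by (auto intro: run_unwritten)
  then obtain u where u: "exec (code q) (run p s) u (run q (run p s))" "u \<le> poly (cost q) M"
    using Then.IH(2)[of "run p s"] Then.prems by auto
  show ?case using t u by (auto intro!: exI[of _ "t + u"] exec.Seq)
next
  case (Cond b p q)
  show ?case
  proof (cases "bval b s")
    case True
    obtain t where t: "exec (code p) s t (run p s)" "t \<le> poly (cost p) M"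
      using Cond.IH(1)[of s] Cond.prems by auto
    show ?thesis using t True by (auto intro!: exI[of _ "Suc t"] exec.IfTrue)
  next
    case False
    obtain t where t: "exec (code q) s t (run q s)" "t \<le> poly (cost q) M"
      using Cond.IH(2)[of s] Cond.prems by auto
    show ?thesis using t False by (auto intro!: exI[of _ "Suc t"] exec.IfFalse)
  qed
next
  case (For i b p)
  define step where "step = (\<lambda>t. update (run p t) i 0 (Suc (run p t i 0)))"
  define body where "body = Seq (code p) (Assign i (Const 0) (Plus (Var i) (Const 1)))"
  define W where "W = While (Less (Var i) (Var b)) body"
  have i: "i \<notin> writes p" "b \<notin> writes p" "i \<noteq> b" using For.prems by auto
  \<comment> \<open>The induction runs over the number \<open>k\<close> of iterations left, the
    distance of the counter from its limit.\<close>
  have W: "\<exists>t. exec W u t ((step ^^ k) u) \<and> t \<le> 1 + k * (2 + poly (cost p) M)"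
    if "\<And>c. c \<in> limits p \<Longrightarrow> u c 0 \<le> M" "k + u i 0 = u b 0" for k u
    using that
  proof (induction k arbitrary: u)
    case 0
    then have "exec W u 1 u" unfolding W_def by (intro exec.WhileFalse) simp
    then show ?case by (intro exI[of _ 1]) simp
  next
    case (Suc k)
    obtain t where t: "exec (code p) u t (run p u)" "t \<le> poly (cost p) M"
      using For.IH[of u] For.prems Suc.prems by auto
    have "exec (Assign i (Const 0) (Plus (Var i) (Const 1))) (run p u) 1 (step u)"
      using exec.Assign[of i "Const 0" "Plus (Var i) (Const 1)" "run p u"] by (simp add: step_def)
    with t(1) have body: "exec body u (t + 1) (step u)" unfolding body_def by (rule exec.Seq)
    have "step u c = u c" if "c \<in> limits p" for c
    proof -
      have "c \<noteq> i" "c \<notin> writes p" using that For.prems(2) by auto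
      then show ?thesis by (simp add: step_def update_other run_unwritten)
    qed
    moreover have "step u b = u b" "step u i 0 = Suc (u i 0)"
      using i by (simp_all add: step_def update_other run_unwritten)
    ultimately obtain v where v: "exec W (step u) v ((step ^^ k) (step u))"
      "v \<le> 1 + k * (2 + poly (cost p) M)"
      using Suc.IH[of "step u"] Suc.prems by auto
    have "exec W u (Suc (t + 1 + v)) ((step ^^ k) (step u))"
      unfolding W_def
      by (rule exec.WhileTrue[OF _ body]) (use v Suc.prems in \<open>auto simp: W_def\<close>)
    then show ?case
      using t(2) v(2) by (intro exI[of _ "Suc (t + 1 + v)"]) (simp add: funpow_swap1)
  qed
  define s0 where "s0 = update s i 0 0"
  have "\<And>c. c \<in> limits p \<Longrightarrow> s0 c 0 \<le> M"
    using For.prems by (auto simp: s0_def)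
  moreover have "s b 0 + s0 i 0 = s0 b 0" using i by (simp add: s0_def)
  ultimately obtain t where t: "exec W s0 t ((step ^^ s b 0) s0)"
    "t \<le> 1 + s b 0 * (2 + poly (cost p) M)"
    using W by blast
  have "exec (Assign i (Const 0) (Const 0)) s 1 s0"
    using exec.Assign[of i "Const 0" "Const 0" s] by (simp add: s0_def)
  from exec.Seq[OF this t(1)]
  have ex: "exec (code (For i b p)) s (1 + t) (run (For i b p) s)"
    by (simp add: W_def body_def s0_def step_def)
  have "s b 0 * (2 + poly (cost p) M) \<le> M * (2 + poly (cost p) M)"
    using For.prems by (intro mult_le_mono1) auto
  with t(2) have "1 + t \<le> poly (cost (For i b p)) M" by simp
  with ex show ?case by blast
qed

text \<open>The rule supplies the counter value and the arrays outside \<open>writes p\<close> to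
  the body, so that an invariant only has to describe what the loop computes.\<close>

lemma run_For:
  assumes "i \<notin> writes p" "i \<noteq> b" "s b 0 = N"
    and "I 0 (update s i 0 0)"
    and "\<And>k t. k < N \<Longrightarrow> t i 0 = k \<Longrightarrow> (\<And>x. x \<notin> insert i (writes p) \<Longrightarrow> t x = s x) \<Longrightarrow> I k t \<Longrightarrow>
      I (Suc k) (update (run p t) i 0 (Suc k))"
  shows "I N (run (For i b p) s)"
proof -
  let ?J = "\<lambda>k t. t i 0 = k \<and> (\<forall>x. x \<notin> insert i (writes p) \<longrightarrow> t x = s x) \<and> I k t"
  have "?J N (run (For i b p) s)"
    unfolding run.simps assms(3)
  proof (rule funpow_invariant[where I = ?J])
    show "?J 0 (update s i 0 0)" using assms(4) by (simp add: update_other)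
    fix k t assume k: "k < N" and J: "?J k t"
    then have I: "I (Suc k) (update (run p t) i 0 (Suc k))" by (intro assms(5)) auto
    have "run p t i 0 = k" using J assms(1) by (simp add: run_unwritten)
    then show "?J (Suc k) (update (run p t) i 0 (Suc (run p t i 0)))"
      using I J by (simp add: update_other run_unwritten)
  qed
  then show ?thesis by simp
qed

section \<open>The auction\<close>

text \<open>Bidders \<open>I\<close> compete for objects \<open>{..<d}\<close>; \<open>B i q\<close> says that bidder \<open>i\<close> is
  interested in \<open>q\<close>. Object \<open>q\<close> has price \<open>p q\<close> and is held by the bidder
  \<open>sl q - 1\<close>, by nobody if \<open>sl q = 0\<close>; \<open>as (Suc i)\<close> is nonzero iff \<open>i\<close> holds an object.\<close>

definition auction_inv ::
  "(nat \<Rightarrow> nat \<Rightarrow> bool) \<Rightarrow> nat set \<Rightarrow> nat \<Rightarrow> nat \<Rightarrow> (nat \<Rightarrow> nat) \<Rightarrow> (nat \<Rightarrow> nat) \<Rightarrow> (nat \<Rightarrow> nat) \<Rightarrow> bool"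
  where "auction_inv B I d L p sl as \<longleftrightarrow>
   (\<forall>q<d. p q \<le> L \<and> (sl q = 0 \<longleftrightarrow> p q = 0)) \<and>
   (\<forall>q<d. \<forall>i. sl q = Suc i \<longrightarrow>
      i \<in> I \<and> B i q \<and> as (Suc i) \<noteq> 0 \<and> (\<forall>q'<d. B i q' \<longrightarrow> p q \<le> Suc (p q'))) \<and>
   (\<forall>q<d. \<forall>q'<d. sl q = sl q' \<longrightarrow> sl q \<noteq> 0 \<longrightarrow> q = q') \<and>
   (\<forall>i\<in>I. as (Suc i) \<noteq> 0 \<longrightarrow> (\<exists>q<d. sl q = Suc i))"

text \<open>The index is shifted so that the code 0 of a free object addresses the dummy cell
  \<open>as 0\<close>; evicting nobody is then no special case.\<close>

definition unassigned :: "nat set \<Rightarrow> (nat \<Rightarrow> nat) \<Rightarrow> nat set" where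
  "unassigned I as = {i \<in> I. as (Suc i) = 0}"

lemma auction_invD:
  assumes "auction_inv B I d L p sl as"
  shows "q < d \<Longrightarrow> p q \<le> L" "q < d \<Longrightarrow> sl q = 0 \<longleftrightarrow> p q = 0"
    "q < d \<Longrightarrow> sl q = Suc i \<Longrightarrow> i \<in> I" "q < d \<Longrightarrow> sl q = Suc i \<Longrightarrow> B i q"
    "q < d \<Longrightarrow> sl q = Suc i \<Longrightarrow> as (Suc i) \<noteq> 0"
    "q < d \<Longrightarrow> sl q = Suc i \<Longrightarrow> q' < d \<Longrightarrow> B i q' \<Longrightarrow> p q \<le> Suc (p q')"
    "q < d \<Longrightarrow> q' < d \<Longrightarrow> sl q = sl q' \<Longrightarrow> sl q \<noteq> 0 \<Longrightarrow> q = q'"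
    "i \<in> I \<Longrightarrow> as (Suc i) \<noteq> 0 \<Longrightarrow> \<exists>q<d. sl q = Suc i"
  using assms unfolding auction_inv_def by blast+

lemma auction_inv_init: "auction_inv B I d L (\<lambda>_. 0) (\<lambda>_. 0) (\<lambda>_. 0)"
  by (simp add: auction_inv_def)

text \<open>Prices only rise, so the bounds of the other holders survive. The new holder pays one
  more than the cheapest price open to it, which is the slack of 1 in the invariant.\<close>

lemma auction_bid:
  assumes inv: "auction_inv B I d L p sl as"
    and i: "i \<in> I" "as (Suc i) = 0"
    and q: "q < d" "B i q" "p q < L" and min: "\<And>q'. q' < d \<Longrightarrow> B i q' \<Longrightarrow> p q \<le> p q'"
  shows "auction_inv B I d L (p(q := Suc (p q))) (sl(q := Suc i)) (as(sl q := 0, Suc i := 1))"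
proof -
  note D = auction_invD[OF inv]
  have free: "sl q' \<noteq> Suc i" if "q' < d" for q'
    using D(5)[OF that] i(2) by auto
  \<comment> \<open>The evicted bidder holds nothing else, so clearing its mark is consistent with
    all other objects.\<close>
  have other: "sl q' \<noteq> sl q" if "q' < d" "q' \<noteq> q" "sl q' \<noteq> 0" for q'
    using D(7)[of q' q] that q by auto
  show ?thesis
    unfolding auction_inv_def
  proof (intro conjI allI impI ballI)
    fix q' assume q': "q' < d"
    show "(p(q := Suc (p q))) q' \<le> L" using D(1)[OF q'] q(3) by simp
    show "((sl(q := Suc i)) q' = 0) = ((p(q := Suc (p q))) q' = 0)" using D(2)[OF q'] by simp
    fix j assume j: "(sl(q := Suc i)) q' = Suc j"
    show "j \<in> I" using j D(3)[OF q'] i by (auto split: if_splits)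
    show "B j q'" using j D(4)[OF q'] q by (auto split: if_splits)
    show "(as(sl q := 0, Suc i := 1)) (Suc j) \<noteq> 0"
      using j D(5)[OF q'] other[OF q'] by (auto split: if_splits)
    fix q'' assume q'': "q'' < d" "B j q''"
    show "(p(q := Suc (p q))) q' \<le> Suc ((p(q := Suc (p q))) q'')"
      using j D(6)[OF q' _ q''] min[OF q''(1)] q''(2) by (auto split: if_splits intro: le_SucI)
  next
    fix q' q'' assume *: "q' < d" "q'' < d" "(sl(q := Suc i)) q' = (sl(q := Suc i)) q''"
      "(sl(q := Suc i)) q' \<noteq> 0"
    then show "q' = q''"
      using D(7)[of q' q''] free[of q'] free[of q''] by (auto split: if_splits)
  next
    fix j assume j: "j \<in> I" "(as(sl q := 0, Suc i := 1)) (Suc j) \<noteq> 0"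
    show "\<exists>q'<d. (sl(q := Suc i)) q' = Suc j"
    proof (cases "j = i")
      case True
      then show ?thesis using q(1) by (intro exI[of _ q]) simp
    next
      case False
      then have "as (Suc j) \<noteq> 0" and ne: "Suc j \<noteq> sl q" using j(2) by (auto split: if_splits)
      then obtain q' where "q' < d" "sl q' = Suc j" using D(8)[OF j(1)] by blast
      then show ?thesis using ne by (intro exI[of _ q']) auto
    qed
  qed
qed

text \<open>A held object exceeds the other options of its holder by at most 1 in price, so if it
  lies above a gap \<open>k\<close>, all these options do. The objects above the gap are thus closed
  under passing to the holder and on to its neighbours. An unassigned bidder sees only prices at the
  limit, which is above any gap.\<close>

lemma unassigned_crown:
  assumes inv: "auction_inv (\<lambda>i q. A i (q mod n)) I (2 * n) (Suc (2 * n)) p sl as"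
    and nbr: "\<And>i. i \<in> I \<Longrightarrow> \<exists>x<n. A i x"
    and stable: "\<And>i q. i \<in> unassigned I as \<Longrightarrow> q < 2 * n \<Longrightarrow> A i (q mod n) \<Longrightarrow> 2 * n < p q"
  obtains R l0 l1 where "R \<subseteq> {..<n}" "inj_on l0 R" "inj_on l1 R" "l0 ` R \<inter> l1 ` R = {}"
    "\<And>x. x \<in> R \<Longrightarrow> l0 x \<in> I - unassigned I as \<and> A (l0 x) x"
    "\<And>x. x \<in> R \<Longrightarrow> l1 x \<in> I - unassigned I as \<and> A (l1 x) x"
    "\<And>i x. i \<in> l0 ` R \<union> l1 ` R \<union> unassigned I as \<Longrightarrow> x < n \<Longrightarrow> A i x \<Longrightarrow> x \<in> R"
proof (cases "unassigned I as = {}")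
  case True
  then show ?thesis using that[of "{}" id id] by simp
next
  case False
  note D = auction_invD[OF inv]
  obtain u where u: "u \<in> unassigned I as" using False by blast
  then obtain y where y: "y < n" "A u y" using nbr by (auto simp: unassigned_def)
  have "p y = Suc (2 * n)" using stable[OF u, of y] D(1)[of y] y by simp
  \<comment> \<open>The price \<open>2 * n + 1\<close> occurs at \<open>y\<close>; if 1 to
    \<open>2 * n\<close> all occurred too, \<open>2 * n\<close> objects would show
    \<open>2 * n + 1\<close> different prices.\<close>
  have "\<exists>k\<in>{1..2 * n}. \<forall>q<2 * n. p q \<noteq> k"
  proof (rule ccontr)
    assume "\<not> (\<exists>k\<in>{1..2 * n}. \<forall>q<2 * n. p q \<noteq> k)"
    then have "\<exists>q<2 * n. p q = k" if "1 \<le> k" "k \<le> 2 * n" for k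
      using that by auto
    then have k: "k \<in> p ` {..<2 * n}" if "1 \<le> k" "k \<le> 2 * n" for k
      using that by (metis imageI lessThan_iff)
    have "k \<in> p ` {..<2 * n}" if "k \<in> {1..Suc (2 * n)}" for k
    proof (cases "k = Suc (2 * n)")
      case True
      have "p y \<in> p ` {..<2 * n}" using y(1) by (intro imageI) simp
      then show ?thesis using True \<open>p y = Suc (2 * n)\<close> by simp
    next
      case False
      then show ?thesis using k that by simp
    qed
    then have "{1..Suc (2 * n)} \<subseteq> p ` {..<2 * n}" by blast
    from card_mono[OF _ this] have "Suc (2 * n) \<le> card (p ` {..<2 * n})" by simp
    also have "\<dots> \<le> 2 * n" using card_image_le[of "{..<2 * n}" p] by simp
    finally show False by simp
  qed
  then obtain k where k: "k \<le> 2 * n" and gap: "\<And>q. q < 2 * n \<Longrightarrow> p q \<noteq> k" by auto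
  define R where "R = {x. x < n \<and> k < p x}"
  have occ: "sl q = Suc (sl q - 1)" if "q < 2 * n" "k < p q" for q
    using D(2)[OF that(1)] that(2) by simp
  have close: "k < p q'" if "q < 2 * n" "k < p q" "q' < 2 * n" "A (sl q - 1) (q' mod n)" for q q'
    using D(6)[OF that(1) occ[OF that(1,2)] that(3,4)] that(2) gap[OF that(3)] by simp
  have held: "sl q - 1 \<in> I - unassigned I as \<and> A (sl q - 1) (q mod n)" if "q < 2 * n" "k < p q" for q
    using D(3,4,5)[OF that(1) occ[OF that]] occ[OF that] by (auto simp: unassigned_def)
  have slinj: "q = q'" if "q < 2 * n" "k < p q" "q' < 2 * n" "k < p q'" "sl q - 1 = sl q' - 1" for q q'
    using D(7)[OF that(1,3)] occ[OF that(1,2)] occ[OF that(3,4)] that(5) by simp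
  define l0 where "l0 = (\<lambda>x. sl x - 1)"
  define l1 where "l1 = (\<lambda>x. sl (x + n) - 1)"
  have R: "x < n" "x < 2 * n" "k < p x" "x + n < 2 * n" "k < p (x + n)" "(x + n) mod n = x"
    if "x \<in> R" for x
  proof -
    show x: "x < n" "x < 2 * n" "k < p x" "x + n < 2 * n" "(x + n) mod n = x"
      using that by (auto simp: R_def)
    \<comment> \<open>The holder of \<open>x\<close> is interested in the second copy as well, so
      that copy lies above the gap and is held, too.\<close>
    show "k < p (x + n)" using close[OF x(2,3,4)] held[OF x(2,3)] x by simp
  qed
  show ?thesis
  proof (rule that[of R l0 l1])
    show "R \<subseteq> {..<n}" by (auto simp: R_def)
    show "inj_on l0 R"
    proof (rule inj_onI)
      fix x y assume xy: "x \<in> R" "y \<in> R" "l0 x = l0 y"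
      show "x = y"
        using slinj[of x y] R[OF xy(1)] R[OF xy(2)] xy(3) by (simp add: l0_def)
    qed
    show "inj_on l1 R"
    proof (rule inj_onI)
      fix x y assume xy: "x \<in> R" "y \<in> R" "l1 x = l1 y"
      show "x = y"
        using slinj[of "x + n" "y + n"] R[OF xy(1)] R[OF xy(2)] xy(3) by (simp add: l1_def)
    qed
    show "l0 ` R \<inter> l1 ` R = {}"
    proof (rule ccontr)
      assume "l0 ` R \<inter> l1 ` R \<noteq> {}"
      then obtain x y where xy: "x \<in> R" "y \<in> R" "l0 x = l1 y" by auto
      have "x = y + n" using slinj[of x "y + n"] R[OF xy(1)] R[OF xy(2)] xy(3) by (simp add: l0_def l1_def)
      then show False using R[OF xy(1)] by simp
    qed
    show "l0 x \<in> I - unassigned I as \<and> A (l0 x) x" if "x \<in> R" for x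
      using held[of x] R[OF that] by (simp add: l0_def)
    show "l1 x \<in> I - unassigned I as \<and> A (l1 x) x" if "x \<in> R" for x
      using held[of "x + n"] R[OF that] by (simp add: l1_def)
    fix i x assume i: "i \<in> l0 ` R \<union> l1 ` R \<union> unassigned I as" and x: "x < n" "A i x"
    consider y where "y \<in> R" "i = l0 y" | y where "y \<in> R" "i = l1 y" | "i \<in> unassigned I as"
      using i by auto
    then have "k < p x"
    proof cases
      case (1 y)
      then show ?thesis using close[of y x] R[OF 1(1)] x by (simp add: l0_def)
    next
      case (2 y)
      then show ?thesis using close[of "y + n" x] R[OF 2(1)] x by (simp add: l1_def)
    next
      case 3
      then show ?thesis using stable[OF 3, of x] x k by simp
    qed
    then show "x \<in> R" using x by (simp add: R_def)
  qed
qed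

text \<open>Sending an object to its holder reaches every assigned bidder, and only the two copies
  of vertices of \<open>X\<close> are ever held.\<close>

lemma card_assigned_le:
  assumes inv: "auction_inv (\<lambda>i q. A i (q mod n)) I (2 * n) L p sl as"
    and X: "finite X" "\<And>i x. i \<in> I \<Longrightarrow> x < n \<Longrightarrow> A i x \<Longrightarrow> x \<in> X"
  shows "card (I - unassigned I as) \<le> 2 * card X"
proof -
  note D = auction_invD[OF inv]
  have "i \<in> (\<lambda>q. sl q - 1) ` (X \<union> (+) n ` X)" if i: "i \<in> I - unassigned I as" for i
  proof -
    obtain q where q: "q < 2 * n" "sl q = Suc i"
      using D(8)[of i] i by (auto simp: unassigned_def)
    have "q mod n < n" using q(1) by (intro mod_less_divisor) auto
    then have "q mod n \<in> X" using X(2)[of i "q mod n"] D(3,4)[OF q] by blast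
    moreover have "q = q mod n \<or> q = n + q mod n"
      using q(1) by (cases "q < n") (simp_all add: le_mod_geq)
    ultimately have "q \<in> X \<union> (+) n ` X" by (metis UnI1 UnI2 imageI)
    then show ?thesis using q(2) by (intro image_eqI[of _ _ q]) simp_all
  qed
  then have "card (I - unassigned I as) \<le> card ((\<lambda>q. sl q - 1) ` (X \<union> (+) n ` X))"
    using X(1) by (intro card_mono) auto
  also have "\<dots> \<le> card (X \<union> (+) n ` X)"
    using X(1) by (intro card_image_le) simp
  also have "\<dots> \<le> card X + card ((+) n ` X)" by (rule card_Un_le)
  also have "\<dots> \<le> 2 * card X" using card_image_le[OF X(1), of "(+) n"] by simp
  finally show ?thesis .
qed

section \<open>Merging the unassigned vertices\<close>

lemma edge_image_iff:
  assumes "ugraph V E"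
  shows "e \<in> (`) f ` E \<longleftrightarrow> (\<exists>a b. {a, b} \<in> E \<and> e = {f a, f b})"
proof
  assume "e \<in> (`) f ` E"
  then obtain e' where "e' \<in> E" "e = f ` e'" by blast
  moreover then have "card e' = 2" using assms by (simp add: ugraph_def)
  ultimately show "\<exists>a b. {a, b} \<in> E \<and> e = {f a, f b}" by (auto simp: card_2_iff)
next
  assume "\<exists>a b. {a, b} \<in> E \<and> e = {f a, f b}"
  then obtain a b where "{a, b} \<in> E" "e = f ` {a, b}" by auto
  then show "e \<in> (`) f ` E" by blast
qed

text \<open>The crown is used twice: in the given graph to get rid of \<open>U\<close>, and in the
  merged graph to get rid of the merged vertex. What is left in both cases avoids \<open>U\<close>,
  where \<open>f\<close> is injective.\<close>

lemma ntst_merge: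
  fixes V :: "'a set" and f :: "'a \<Rightarrow> 'b"
  assumes inst: "ntst_instance V E NT"
    and f: "\<And>x y. x \<in> V \<Longrightarrow> y \<in> V \<Longrightarrow> f x = f y \<longleftrightarrow> x = y \<or> x \<in> U \<and> y \<in> U"
    and U: "U \<subseteq> V"
    and inj: "inj_on l0 R" "inj_on l1 R" "l0 ` R \<inter> l1 ` R = {}"
    and edge: "\<And>x. x \<in> R \<Longrightarrow> {x, l0 x} \<in> E \<and> {x, l1 x} \<in> E"
    and nbhd: "\<And>u v. u \<in> l0 ` R \<union> l1 ` R \<union> U \<Longrightarrow> {u, v} \<in> E \<Longrightarrow> v \<in> R"
    and disj: "R \<inter> (l0 ` R \<union> l1 ` R \<union> U) = {}" "(l0 ` R \<union> l1 ` R) \<inter> U = {}"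
      "NT \<inter> (l0 ` R \<union> l1 ` R \<union> U) = {}"
  shows "ntst_instance (f ` V) ((`) f ` E) (f ` NT)"
    and "ntst_yes (f ` V) ((`) f ` E) (f ` NT) \<longleftrightarrow> ntst_yes V E NT"
proof -
  have ug: "ugraph V E" and con: "graph_connected V E" and NT: "NT \<subseteq> V" "card NT + 2 \<le> card V"
    using inst by (auto simp: ntst_instance_def)
  have finV: "finite V" using ug by (simp add: ugraph_def)
  have EV: "a \<in> V" "b \<in> V" "a \<noteq> b" if "{a, b} \<in> E" for a b
    using ug that by (fastforce simp: ugraph_def)+
  have RV: "R \<subseteq> V" "l0 ` R \<subseteq> V" "l1 ` R \<subseteq> V" using edge EV by blast+
  \<comment> \<open>Vertices of \<open>U\<close> have neighbours only in \<open>R\<close>, so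
    merging them creates no loop.\<close>
  have sep: "f a \<noteq> f b" if "{a, b} \<in> E" for a b
  proof
    assume "f a = f b"
    then have "a \<in> U" "b \<in> U" using f[of a b] EV[OF that] by auto
    then show False using nbhd[of a b] that disj(1) by auto
  qed
  note img = edge_image_iff[OF ug, of _ f]
  have ug': "ugraph (f ` V) ((`) f ` E)"
    unfolding ugraph_def
  proof (intro conjI ballI)
    fix e assume "e \<in> (`) f ` E"
    from iffD1[OF img this] obtain a b where ab: "{a, b} \<in> E" "e = {f a, f b}" by auto
    show "e \<subseteq> f ` V" using ab EV by auto
    show "card e = 2" using sep[OF ab(1)] ab(2) by simp
  qed (use finV in simp)
  have con': "graph_connected (f ` V) ((`) f ` E)" by (rule graph_connected_image[OF con])
  \<comment> \<open>The condition on the number of vertices has to survive merging: two vertices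
    outside \<open>NT\<close> and \<open>U\<close> keep distinct images outside the image of
    \<open>NT\<close>. If \<open>U\<close> is nonempty, it has a neighbour in the head, whose two
    leaves serve.\<close>
  have "\<exists>a\<in>V - NT - U. \<exists>b\<in>V - NT - U. a \<noteq> b"
  proof (cases "U = {}")
    case True
    have "2 \<le> card (V - NT)" using NT card_Diff_subset[of NT V] finite_subset[OF NT(1) finV] by simp
    then obtain S where "S \<subseteq> V - NT" "card S = 2" by (rule obtain_subset_with_card_n) auto
    then show ?thesis using True by (auto simp: card_2_iff)
  next
    case False
    then obtain u where u: "u \<in> U" by blast
    have "\<exists>w\<in>V. w \<noteq> u"
    proof (rule ccontr)
      assume "\<not> (\<exists>w\<in>V. w \<noteq> u)"
      then have "V \<subseteq> {u}" by blast
      then have "card V \<le> 1" using card_mono[of "{u}" V] by simp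
      then show False using NT(2) by simp
    qed
    then obtain w where "w \<in> V" "w \<noteq> u" by blast
    then have "reach E u w" using con u U by (auto simp: graph_connected_reach)
    then obtain e where e: "e \<in> E" "u \<in> e"
      using reach_isolated[of E u w] \<open>w \<noteq> u\<close> by meson
    then have "card e = 2" using ug by (simp add: ugraph_def)
    with e(2) obtain v where "e = {u, v}" by (auto simp: card_2_iff)
    with e(1) have "{u, v} \<in> E" by simp
    then have "v \<in> R" using nbhd u by blast
    then have "l0 v \<in> V - NT - U" "l1 v \<in> V - NT - U" "l0 v \<noteq> l1 v"
      using RV disj inj(3) by auto
    then show ?thesis by blast
  qed
  then obtain a b where ab: "a \<in> V - NT - U" "b \<in> V - NT - U" "a \<noteq> b" by blast
  have fab: "f a \<noteq> f b" "f a \<notin> f ` NT" "f b \<notin> f ` NT"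
    using ab f NT(1) by auto
  have "card (f ` NT) + 2 = card (f ` NT \<union> {f a, f b})"
    using fab finite_subset[OF NT(1) finV] by simp
  also have "\<dots> \<le> card (f ` V)"
    using finV NT(1) ab by (intro card_mono) auto
  finally show "ntst_instance (f ` V) ((`) f ` E) (f ` NT)"
    using ug' con' NT(1) by (auto simp: ntst_instance_def)

  define E0 where "E0 = {e \<in> E. e \<inter> U = {}}"
  have fV: "inj_on f (V - U)" using f by (auto simp: inj_on_def)
  have "forest_feasible E NT \<longleftrightarrow> forest_feasible E0 NT"
    unfolding E0_def by (rule forest_feasible_crown[OF ug edge inj nbhd disj])
  also have "\<dots> \<longleftrightarrow> forest_feasible ((`) f ` E0) (f ` NT)"
  proof (rule forest_feasible_image[symmetric])
    show "inj_on f (V - U)" by (rule fV)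
    show "\<Union>E0 \<subseteq> V - U" using ug by (auto simp: E0_def ugraph_def)
    show "NT \<subseteq> V - U" using NT(1) disj by auto
  qed (use finV in simp)
  also have "(`) f ` E0 = {e \<in> (`) f ` E. e \<inter> f ` U = {}}"
  proof -
    have "f ` e \<inter> f ` U = {} \<longleftrightarrow> e \<inter> U = {}" if "e \<in> E" for e
    proof -
      have "e \<subseteq> V" using ug that by (simp add: ugraph_def)
      then show ?thesis using f U by (auto simp: subset_iff)
    qed
    then show ?thesis by (auto simp: E0_def)
  qed
  also have "forest_feasible {e \<in> (`) f ` E. e \<inter> f ` U = {}} (f ` NT) \<longleftrightarrow>
      forest_feasible ((`) f ` E) (f ` NT)"
  proof -
    \<comment> \<open>\<open>g\<close> recovers a head vertex from its image, so that
      \<open>f \<circ> l0 \<circ> g\<close> selects its leaf in the merged graph.\<close>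
    define g where "g = inv_into R f"
    have fR: "inj_on f (R \<union> l0 ` R \<union> l1 ` R)"
      by (rule inj_on_subset[OF fV]) (use RV disj in blast)
    have g: "g (f x) = x" if "x \<in> R" for x
      using that fR by (auto simp: g_def intro: inv_into_f_f inj_on_subset)
    have im: "(f \<circ> l0 \<circ> g) ` f ` R = f ` l0 ` R" "(f \<circ> l1 \<circ> g) ` f ` R = f ` l1 ` R"
      using g by (simp_all add: image_image cong: image_cong_simp)
    have dis: "f ` S \<inter> f ` S' = {}" if "S \<subseteq> V" "S' \<subseteq> V" "S \<inter> S' = {}" "S \<inter> U = {}" for S S'
    proof -
      have "f a \<noteq> f b" if "a \<in> S" "b \<in> S'" for a b
        using f[of a b] that \<open>S \<subseteq> V\<close> \<open>S' \<subseteq> V\<close> \<open>S \<inter> S' = {}\<close> \<open>S \<inter> U = {}\<close> by blast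
      then show ?thesis by blast
    qed
    have disj': "R \<subseteq> V" "l0 ` R \<subseteq> V" "l1 ` R \<subseteq> V" "U \<subseteq> V" "NT \<subseteq> V" "l0 ` R \<inter> l1 ` R = {}"
      "R \<inter> l0 ` R = {}" "R \<inter> l1 ` R = {}" "R \<inter> U = {}" "l0 ` R \<inter> U = {}" "l1 ` R \<inter> U = {}"
      "NT \<inter> l0 ` R = {}" "NT \<inter> l1 ` R = {}" "NT \<inter> U = {}"
      "R \<inter> (l0 ` R \<union> l1 ` R \<union> U) = {}" "(l0 ` R \<union> l1 ` R) \<inter> U = {}"
      "NT \<inter> (l0 ` R \<union> l1 ` R \<union> U) = {}"
      using RV U NT(1) inj(3) disj unfolding Int_Un_distrib Int_Un_distrib2 Un_empty by simp_all
    have inj': "inj_on (f \<circ> l \<circ> g) (f ` R)" if l: "inj_on l R" "l ` R \<subseteq> V - U" for l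
    proof (rule inj_onI)
      fix a b assume ab: "a \<in> f ` R" "b \<in> f ` R" "(f \<circ> l \<circ> g) a = (f \<circ> l \<circ> g) b"
      then obtain x y where xy: "x \<in> R" "y \<in> R" "a = f x" "b = f y" by blast
      then have "f (l x) = f (l y)" using ab(3) g by simp
      then have "l x = l y" by (rule inj_onD[OF fV]) (use l(2) xy in auto)
      then show "a = b" using inj_onD[OF l(1)] xy by blast
    qed
    \<comment> \<open>\<open>f\<close> identifies vertices only inside \<open>U\<close>, so a set
      containing \<open>U\<close> can be read off from its image.\<close>
    have mem: "a \<in> S" if "f a \<in> f ` S" "a \<in> V" "S \<subseteq> V" "U \<subseteq> S" for a S
    proof -
      obtain b where "b \<in> S" "f a = f b" using \<open>f a \<in> f ` S\<close> by blast
      then show ?thesis using f[of a b] that(2-4) by blast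
    qed
    show ?thesis
    proof (rule forest_feasible_crown[OF ug', symmetric, where R = "f ` R"
          and ?l0.0 = "f \<circ> l0 \<circ> g" and ?l1.0 = "f \<circ> l1 \<circ> g"], unfold im)
      fix x assume "x \<in> f ` R"
      then obtain y where y: "y \<in> R" "x = f y" by blast
      have "f ` {y, l0 y} \<in> (`) f ` E \<and> f ` {y, l1 y} \<in> (`) f ` E"
        using edge[OF y(1)] by (intro conjI imageI) simp_all
      then show "{x, (f \<circ> l0 \<circ> g) x} \<in> (`) f ` E \<and> {x, (f \<circ> l1 \<circ> g) x} \<in> (`) f ` E"
        using y(2) g[OF y(1)] by simp
    next
      have "l0 ` R \<subseteq> V - U" "l1 ` R \<subseteq> V - U" using RV disj by blast+
      then show "inj_on (f \<circ> l0 \<circ> g) (f ` R)" "inj_on (f \<circ> l1 \<circ> g) (f ` R)"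
        using inj' inj(1,2) by auto
    next
      show "f ` l0 ` R \<inter> f ` l1 ` R = {}"
        by (rule dis) (use disj' in simp_all)
    next
      fix u v assume u: "u \<in> f ` l0 ` R \<union> f ` l1 ` R \<union> f ` U" and uv: "{u, v} \<in> (`) f ` E"
      from iffD1[OF img uv] obtain a b where ab: "{a, b} \<in> E" "{u, v} = {f a, f b}" by auto
      then have "u = f a \<and> v = f b \<or> u = f b \<and> v = f a" "{b, a} \<in> E"
        by (auto simp: doubleton_eq_iff insert_commute)
      with ab(1) obtain a b where ab: "{a, b} \<in> E" "u = f a" "v = f b" by metis
      have "a \<in> l0 ` R \<union> l1 ` R \<union> U"
        by (rule mem) (use u ab EV RV U in \<open>auto simp: image_Un\<close>)
      then show "v \<in> f ` R" using nbhd ab by blast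
    next
      show "f ` R \<inter> (f ` l0 ` R \<union> f ` l1 ` R \<union> f ` U) = {}"
        unfolding image_Un[symmetric] by (rule dis) (use disj' in simp_all)
      show "(f ` l0 ` R \<union> f ` l1 ` R) \<inter> f ` U = {}"
        unfolding image_Un[symmetric] by (rule dis) (use disj' in simp_all)
      show "f ` NT \<inter> (f ` l0 ` R \<union> f ` l1 ` R \<union> f ` U) = {}"
        unfolding image_Un[symmetric] by (rule dis) (use disj' in simp_all)
    qed
  qed
  finally show "ntst_yes (f ` V) ((`) f ` E) (f ` NT) \<longleftrightarrow> ntst_yes V E NT"
    using ntst_yes_iff_forest_feasible ug con ug' con' by metis
qed

text \<open>Outside a vertex cover no two vertices are adjacent, so every edge at
  \<open>NT - X\<close> leads into \<open>X\<close> and the double count applies.\<close>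

lemma ntst_yes_card:
  assumes inst: "ntst_instance V E NT" and yes: "ntst_yes V E NT"
    and X: "vertex_cover V E X" "X \<noteq> {}"
  shows "card (NT - X) < card X"
proof -
  have ug: "ugraph V E" and con: "graph_connected V E" and NT: "NT \<subseteq> V"
    using inst by (auto simp: ntst_instance_def)
  then have fin: "finite V" by (simp add: ugraph_def)
  obtain F where F: "F \<subseteq> E" "forest F" "\<And>v. v \<in> NT \<Longrightarrow> 2 \<le> degree_in F v"
    using yes ntst_yes_iff_forest_feasible[OF ug con] by (auto simp: forest_feasible_def)
  have XV: "X \<subseteq> V" using X(1) by (simp add: vertex_cover_def)
  show ?thesis
  proof (rule forest_independent_side[OF _ _ X(2) F(2)])
    show "finite (NT - X)" "finite X" using NT XV fin by (auto intro: finite_subset)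
    show "\<exists>i\<in>NT - X. \<exists>x\<in>X. e = {i, x}" if e: "e \<in> F" "e \<inter> (NT - X) \<noteq> {}" for e
    proof -
      obtain i where i: "i \<in> e" "i \<in> NT - X" using e(2) by blast
      have "e \<in> E" using e F by blast
      then obtain x where x: "x \<in> e" "x \<in> X" using X(1) by (auto simp: vertex_cover_def)
      have "card e = 2" using ug \<open>e \<in> E\<close> by (simp add: ugraph_def)
      then have "e = {i, x}" using i x by (auto simp: card_2_iff)
      then show ?thesis using i x by blast
    qed
  qed (use F(3) in auto)
qed

section \<open>The kernelization program\<close>

text \<open>Cell 0 of \<open>m\<close>, \<open>d\<close>, \<open>nn\<close>, \<open>L\<close> and \<open>r\<close> holds the number \<open>n\<close> of vertices, \<open>2 * n\<close>,
  \<open>n * n\<close>, the price limit \<open>2 * n + 1\<close> and the number of auction rounds; \<open>row\<close> holds the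
  multiples of \<open>n\<close>.\<close>

definition init :: prog where
  "init = Set ''m'' (Const 0) (Var ''n'') ;; Set ''d'' (Const 0) (Plus (Var ''m'') (Var ''m'')) ;;
     Set ''L'' (Const 0) (Plus (Var ''d'') (Const 1))"

text \<open>The machine has no multiplication, so products are accumulated by repeated
  addition.\<close>

definition tables :: prog where
  "tables = For ''i'' ''m'' (Set ''row'' (Plus (Var ''i'') (Const 1))
       (Plus (Cell ''row'' (Var ''i'')) (Var ''m''))) ;;
     Set ''nn'' (Const 0) (Cell ''row'' (Var ''m'')) ;;
     Set ''r'' (Const 0) (Const 1) ;;
     For ''q'' ''d'' (Set ''r'' (Const 0) (Plus (Var ''r'') (Var ''L'')))"

text \<open>The input moves to \<open>g\<close> and \<open>t\<close>, which frees \<open>adj\<close>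
  and \<open>nt\<close> for the output. \<open>md\<close> tabulates \<open>q mod n\<close> over both
  copies of the vertices.\<close>

definition load :: prog where
  "load = For ''z'' ''nn'' (Set ''g'' (Var ''z'') (Cell ''adj'' (Var ''z'')) ;;
       Set ''adj'' (Var ''z'') (Const 0)) ;;
     For ''i'' ''m'' (Set ''t'' (Var ''i'') (Cell ''nt'' (Var ''i'')) ;; Set ''nt'' (Var ''i'') (Const 0) ;;
       Set ''md'' (Var ''i'') (Var ''i'') ;; Set ''md'' (Plus (Var ''m'') (Var ''i'')) (Var ''i''))"

text \<open>The value in \<open>r\<close> is one more than the largest possible sum of
  \<open>2 * n\<close> prices bounded by \<open>2 * n + 1\<close>.\<close>

definition limits_ok :: "nat \<Rightarrow> state \<Rightarrow> bool" where
  "limits_ok n s \<longleftrightarrow> s ''m'' 0 = n \<and> s ''d'' 0 = 2 * n \<and> s ''L'' 0 = Suc (2 * n) \<and> s ''nn'' 0 = n * n \<and>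
     s ''r'' 0 = Suc (2 * n * Suc (2 * n)) \<and> (\<forall>i\<le>n. s ''row'' i = i * n)"

definition loaded :: "nat \<Rightarrow> nat set set \<Rightarrow> nat set \<Rightarrow> state \<Rightarrow> bool" where
  "loaded n E NT s \<longleftrightarrow> limits_ok n s \<and> (\<forall>i<n. \<forall>j<n. s ''g'' (i * n + j) = of_bool ({i, j} \<in> E)) \<and>
     (\<forall>i<n. s ''t'' i = of_bool (i \<in> NT)) \<and> (\<forall>q<2 * n. s ''md'' q = q mod n)"

lemma loadedD:
  assumes "loaded n E NT s"
  shows "s ''m'' 0 = n" "s ''d'' 0 = 2 * n" "s ''L'' 0 = Suc (2 * n)" "s ''nn'' 0 = n * n"
    "s ''r'' 0 = Suc (2 * n * Suc (2 * n))" "i \<le> n \<Longrightarrow> s ''row'' i = i * n"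
    "i < n \<Longrightarrow> j < n \<Longrightarrow> s ''g'' (i * n + j) = of_bool ({i, j} \<in> E)"
    "i < n \<Longrightarrow> s ''t'' i = of_bool (i \<in> NT)" "q < 2 * n \<Longrightarrow> s ''md'' q = q mod n"
  using assms by (simp_all add: loaded_def limits_ok_def)

lemma limits_ok_cong:
  assumes "limits_ok n s" "\<And>x. x \<in> {''m'', ''d'', ''L'', ''nn'', ''r'', ''row''} \<Longrightarrow> s' x = s x"
  shows "limits_ok n s'"
  using assms by (simp add: limits_ok_def)

lemma loaded_cong:
  assumes "loaded n E NT s"
    "\<And>x. x \<in> {''m'', ''d'', ''L'', ''nn'', ''r'', ''row'', ''g'', ''t'', ''md''} \<Longrightarrow> s' x = s x"
  shows "loaded n E NT s'"
  using assms by (simp add: loaded_def limits_ok_def)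

lemma loaded_run:
  assumes "loaded n E NT s"
    "{''m'', ''d'', ''L'', ''nn'', ''r'', ''row'', ''g'', ''t'', ''md''} \<inter> writes p = {}"
  shows "loaded n E NT (run p s)"
  using assms(1) by (rule loaded_cong) (use assms(2) in \<open>auto intro!: run_unwritten\<close>)

lemma run_tables:
  assumes s: "s ''m'' 0 = n" "s ''d'' 0 = 2 * n" "s ''L'' 0 = Suc (2 * n)" "s ''row'' 0 = 0"
  shows "limits_ok n (run tables s)"
proof -
  let ?rows = "For ''i'' ''m'' (Set ''row'' (Plus (Var ''i'') (Const 1))
       (Plus (Cell ''row'' (Var ''i'')) (Var ''m'')))"
  define s1 where "s1 = run ?rows s"
  have rows: "\<forall>i\<le>n. s1 ''row'' i = i * n"
    unfolding s1_def
    by (rule run_For[where I = "\<lambda>k t. \<forall>i\<le>k. t ''row'' i = i * n"]) (use s in \<open>auto simp: le_Suc_eq\<close>)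
  have s1: "s1 x = s x" if "x \<notin> {''i'', ''row''}" for x
    unfolding s1_def using that by (intro run_unwritten) simp
  define s2 where "s2 = update (update s1 ''nn'' 0 (s1 ''row'' n)) ''r'' 0 1"
  have s2: "s2 ''d'' 0 = 2 * n" "s2 ''L'' 0 = Suc (2 * n)" "s2 ''r'' 0 = 1" "s2 ''nn'' 0 = n * n"
    using s s1 rows by (simp_all add: s2_def)
  let ?rounds = "For ''q'' ''d'' (Set ''r'' (Const 0) (Plus (Var ''r'') (Var ''L'')))"
  define s3 where "s3 = run ?rounds s2"
  have "s3 ''r'' 0 = Suc (2 * n * Suc (2 * n))"
    unfolding s3_def
    by (rule run_For[where I = "\<lambda>k t. t ''r'' 0 = Suc (k * Suc (2 * n))"]) (use s2 in auto)
  moreover have "s3 x = s2 x" if "x \<notin> {''q'', ''r''}" for x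
    unfolding s3_def using that by (intro run_unwritten) simp
  ultimately have "limits_ok n s3"
    using s s1 rows s2 by (simp add: limits_ok_def s2_def)
  moreover have "run ?rows s ''m'' 0 = n"
    using s1[of "''m''"] s(1) by (simp add: s1_def)
  then have "run tables s = s3"
    by (simp add: tables_def s3_def s2_def s1_def del: run.simps(5) update_row)
  ultimately show ?thesis by simp
qed

lemma run_load:
  assumes lim: "limits_ok n s"
    and adj: "\<And>i. s ''adj'' i = of_bool ({i div n, i mod n} \<in> E)"
    and nt: "\<And>i. s ''nt'' i = of_bool (i \<in> NT)"
  shows "loaded n E NT (run load s)"
    and "\<And>z. z < n * n \<Longrightarrow> run load s ''adj'' z = 0" and "\<And>i. i < n \<Longrightarrow> run load s ''nt'' i = 0"
proof -
  let ?p = "For ''z'' ''nn'' (Set ''g'' (Var ''z'') (Cell ''adj'' (Var ''z'')) ;;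
       Set ''adj'' (Var ''z'') (Const 0))"
  let ?q = "For ''i'' ''m'' (Set ''t'' (Var ''i'') (Cell ''nt'' (Var ''i'')) ;; Set ''nt'' (Var ''i'') (Const 0) ;;
       Set ''md'' (Var ''i'') (Var ''i'') ;; Set ''md'' (Plus (Var ''m'') (Var ''i'')) (Var ''i''))"
  define s1 where "s1 = run ?p s"
  define s2 where "s2 = run ?q s1"
  have l: "s ''nn'' 0 = n * n" "s ''m'' 0 = n" using lim by (simp_all add: limits_ok_def)
  have p: "(\<forall>z<n * n. s1 ''g'' z = s ''adj'' z \<and> s1 ''adj'' z = 0) \<and> (\<forall>z\<ge>n * n. s1 ''adj'' z = s ''adj'' z)"
    unfolding s1_def
    by (rule run_For[where I = "\<lambda>k t. (\<forall>z<k. t ''g'' z = s ''adj'' z \<and> t ''adj'' z = 0) \<and>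
          (\<forall>z\<ge>k. t ''adj'' z = s ''adj'' z)"]) (use l in \<open>auto simp: less_Suc_eq\<close>)
  have s1: "s1 x = s x" if "x \<notin> {''z'', ''g'', ''adj''}" for x
    unfolding s1_def using that by (intro run_unwritten) simp
  have q: "(\<forall>i<n. s2 ''t'' i = s ''nt'' i \<and> s2 ''nt'' i = 0 \<and> s2 ''md'' i = i \<and> s2 ''md'' (n + i) = i) \<and>
      (\<forall>i\<ge>n. s2 ''nt'' i = s ''nt'' i)"
    unfolding s2_def
    by (rule run_For[where I = "\<lambda>k t. (\<forall>i<k. t ''t'' i = s ''nt'' i \<and> t ''nt'' i = 0 \<and> t ''md'' i = i \<and>
          t ''md'' (n + i) = i) \<and> (\<forall>i\<ge>k. t ''nt'' i = s ''nt'' i)"])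
      (use l s1 in \<open>auto simp: less_Suc_eq\<close>)
  have s2: "s2 x = s1 x" if "x \<notin> {''i'', ''t'', ''nt'', ''md''}" for x
    unfolding s2_def using that by (intro run_unwritten) simp
  have run: "run load s = s2" by (simp add: load_def s2_def s1_def)
  have "s2 ''g'' (i * n + j) = of_bool ({i, j} \<in> E)" if ij: "i < n" "j < n" for i j
  proof -
    have "i * n + j < Suc i * n" using ij by simp
    also have "\<dots> \<le> n * n" using ij by (intro mult_le_mono1) simp
    finally show ?thesis using p s2 adj ij by simp
  qed
  moreover have "s2 ''md'' i = i mod n" if i: "i < 2 * n" for i
  proof (cases "i < n")
    case False
    then obtain j where "i = n + j" "j < n" using i by (metis add_less_cancel_left le_iff_add mult_2 not_le)
    then show ?thesis using q by simp
  qed (use q in simp)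
  moreover have "limits_ok n s2"
    using lim
  proof (rule limits_ok_cong)
    fix x assume x: "x \<in> {''m'', ''d'', ''L'', ''nn'', ''r'', ''row''}"
    have "s2 x = s1 x" by (rule s2) (use x in auto)
    also have "s1 x = s x" by (rule s1) (use x in auto)
    finally show "s2 x = s x" .
  qed
  ultimately show "loaded n E NT (run load s)"
    unfolding run using q nt by (simp add: loaded_def)
  show "\<And>z. z < n * n \<Longrightarrow> run load s ''adj'' z = 0" "\<And>i. i < n \<Longrightarrow> run load s ''nt'' i = 0"
    unfolding run using p q s2 by simp_all
qed

subsection \<open>A vertex cover\<close>

definition cover_body :: prog where
  "cover_body = Cond (And (Less (Const 0) (Cell ''g'' (Plus (Cell ''row'' (Var ''i'')) (Var ''j''))))
       (And (Less (Cell ''c'' (Var ''i'')) (Const 1)) (Less (Cell ''c'' (Var ''j'')) (Const 1))))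
     (Set ''c'' (Var ''i'') (Const 1) ;; Set ''c'' (Var ''j'') (Const 1) ;;
      Set ''xc'' (Const 0) (Plus (Var ''xc'') (Const 2)))
     Nop"

definition cover :: prog where
  "cover = For ''i'' ''m'' (For ''j'' ''m'' cover_body)"

text \<open>The matching is not stored. Its trace is that every vertex cover contains at least half
  as many marked vertices as there are; \<open>D\<close> collects the pairs examined so far.\<close>

definition cover_inv :: "nat set set \<Rightarrow> nat \<Rightarrow> (nat \<Rightarrow> nat) \<Rightarrow> nat \<Rightarrow> (nat \<times> nat) set \<Rightarrow> bool" where
  "cover_inv E n c xc D \<longleftrightarrow> {v. c v \<noteq> 0} \<subseteq> {..<n} \<and> xc = card {v. c v \<noteq> 0} \<and>
     (\<forall>C. vertex_cover {..<n} E C \<longrightarrow> xc \<le> 2 * card (C \<inter> {v. c v \<noteq> 0})) \<and>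
     (\<forall>(i, j)\<in>D. {i, j} \<in> E \<longrightarrow> c i \<noteq> 0 \<or> c j \<noteq> 0)"

lemma cover_inv_init: "cover_inv E n (\<lambda>_. 0) 0 {}"
  by (simp add: cover_inv_def)

lemma cover_inv_skip:
  assumes "cover_inv E n c xc D" "{i, j} \<in> E \<Longrightarrow> c i \<noteq> 0 \<or> c j \<noteq> 0"
  shows "cover_inv E n c xc (insert (i, j) D)"
  using assms by (auto simp: cover_inv_def)

text \<open>A cover contains an end of the new edge, and neither end was marked before:
  \<open>xc\<close> grows by 2 and the intersection by at least 1.\<close>

lemma cover_inv_match:
  assumes inv: "cover_inv E n c xc D" and ij: "i < n" "j < n" "{i, j} \<in> E" "i \<noteq> j" "c i = 0" "c j = 0"
  shows "cover_inv E n (c(i := 1, j := 1)) (Suc (Suc xc)) (insert (i, j) D)"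
proof -
  define X where "X = {v. c v \<noteq> 0}"
  have X: "X \<subseteq> {..<n}" "xc = card X" "i \<notin> X" "j \<notin> X"
    and C: "\<And>C. vertex_cover {..<n} E C \<Longrightarrow> xc \<le> 2 * card (C \<inter> X)"
    and D: "\<And>i j. (i, j) \<in> D \<Longrightarrow> {i, j} \<in> E \<Longrightarrow> c i \<noteq> 0 \<or> c j \<noteq> 0"
    using inv ij by (auto simp: cover_inv_def X_def)
  have fin: "finite X" using X(1) finite_subset by blast
  have new: "{v. (c(i := 1, j := 1)) v \<noteq> 0} = insert i (insert j X)" by (auto simp: X_def)
  have C': "Suc (Suc xc) \<le> 2 * card (C \<inter> insert i (insert j X))" if cov: "vertex_cover {..<n} E C" for C
  proof -
    have "C \<inter> {i, j} \<noteq> {}" using cov ij(3) by (auto simp: vertex_cover_def)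
    then obtain v where v: "v \<in> {i, j}" "v \<in> C" by blast
    have "Suc (card (C \<inter> X)) = card (insert v (C \<inter> X))"
      using v(1) X fin by auto
    also have "\<dots> \<le> card (C \<inter> insert i (insert j X))"
      using v fin by (intro card_mono) auto
    finally show ?thesis using C[OF cov] by simp
  qed
  have sub: "insert i (insert j X) \<subseteq> {..<n}" using X(1) ij by simp
  have card: "card (insert i (insert j X)) = Suc (Suc xc)" using X fin ij(4) by simp
  have D': "(c(i := 1, j := 1)) a \<noteq> 0 \<or> (c(i := 1, j := 1)) b \<noteq> 0"
    if "(a, b) \<in> insert (i, j) D" "{a, b} \<in> E" for a b
    using that D[of a b] by auto
  show ?thesis
    unfolding cover_inv_def new
  proof (intro conjI allI impI ballI)
    fix e assume "e \<in> insert (i, j) D"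
    then show "case e of (a, b) \<Rightarrow> {a, b} \<in> E \<longrightarrow>
        (c(i := 1, j := 1)) a \<noteq> 0 \<or> (c(i := 1, j := 1)) b \<noteq> 0"
      using D' by (cases e) simp
  qed (use sub card C' in simp_all)
qed

lemma run_cover:
  assumes ld: "loaded n E NT s" and init: "s ''c'' = (\<lambda>_. 0)" "s ''xc'' 0 = 0"
    and loop: "\<And>i. {i, i} \<notin> E"
  shows "cover_inv E n (run cover s ''c'') (run cover s ''xc'' 0) ({..<n} \<times> {..<n})"
  unfolding cover_def
proof (rule run_For[where I = "\<lambda>k t. cover_inv E n (t ''c'') (t ''xc'' 0) ({..<k} \<times> {..<n})"])
  fix k t
  assume k: "k < n" "t ''i'' 0 = k"
    and fr: "\<And>x. x \<notin> insert ''i'' (writes (For ''j'' ''m'' cover_body)) \<Longrightarrow> t x = s x"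
    and inv: "cover_inv E n (t ''c'') (t ''xc'' 0) ({..<k} \<times> {..<n})"
  let ?u = "run (For ''j'' ''m'' cover_body) t"
  have ldt: "loaded n E NT t"
    using ld by (rule loaded_cong) (auto intro!: fr simp: cover_body_def)
  have "cover_inv E n (?u ''c'') (?u ''xc'' 0) ({..<k} \<times> {..<n} \<union> {k} \<times> {..<n})"
  proof (rule run_For[where I = "\<lambda>l u. cover_inv E n (u ''c'') (u ''xc'' 0)
        ({..<k} \<times> {..<n} \<union> {k} \<times> {..<l})"])
    show "cover_inv E n (update t ''j'' 0 0 ''c'') (update t ''j'' 0 0 ''xc'' 0)
        ({..<k} \<times> {..<n} \<union> {k} \<times> {..<0})"
      using inv by simp
  next
    fix l u
    assume l: "l < n" "u ''j'' 0 = l"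
      and fr: "\<And>x. x \<notin> insert ''j'' (writes cover_body) \<Longrightarrow> u x = t x"
      and inv: "cover_inv E n (u ''c'') (u ''xc'' 0) ({..<k} \<times> {..<n} \<union> {k} \<times> {..<l})"
    have "loaded n E NT u"
      using ldt by (rule loaded_cong) (auto intro!: fr simp: cover_body_def)
    note L = loadedD[OF this]
    have i: "u ''i'' 0 = k" using k fr[of "''i''"] by (simp add: cover_body_def)
    have g: "u ''g'' (k * n + l) = of_bool ({k, l} \<in> E)" using L(7) k l by simp
    have row: "u ''row'' k = k * n" using L(6) k by simp
    have D: "{..<k} \<times> {..<n} \<union> {k} \<times> {..<Suc l} = insert (k, l) ({..<k} \<times> {..<n} \<union> {k} \<times> {..<l})"
      by auto
    have kl: "k \<noteq> l" if "{k, l} \<in> E" using that loop by auto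
    show "cover_inv E n (update (run cover_body u) ''j'' 0 (Suc l) ''c'')
        (update (run cover_body u) ''j'' 0 (Suc l) ''xc'' 0) ({..<k} \<times> {..<n} \<union> {k} \<times> {..<Suc l})"
    proof (cases "{k, l} \<in> E \<and> u ''c'' k = 0 \<and> u ''c'' l = 0")
      case True
      then show ?thesis
        using cover_inv_match[OF inv k(1) l(1)] kl unfolding D
        by (simp add: cover_body_def i l g row)
    next
      case False
      then have "cover_inv E n (u ''c'') (u ''xc'' 0) (insert (k, l) ({..<k} \<times> {..<n} \<union> {k} \<times> {..<l}))"
        using cover_inv_skip[OF inv, of k l] by blast
      moreover have "run cover_body u = u"
        using False by (auto simp: cover_body_def i l g row)
      ultimately show ?thesis unfolding D by simp
    qed
  qed (use loadedD(1)[OF ldt] in \<open>simp_all add: cover_body_def\<close>)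
  moreover have "{..<k} \<times> {..<n} \<union> {k} \<times> {..<n} = {..<Suc k} \<times> {..<n}" by auto
  ultimately show "cover_inv E n (update ?u ''i'' 0 (Suc k) ''c'') (update ?u ''i'' 0 (Suc k) ''xc'' 0)
      ({..<Suc k} \<times> {..<n})" by (simp del: run.simps(5))
qed (use init cover_inv_init loadedD(1)[OF ld] in \<open>simp_all add: cover_body_def\<close>)

subsection \<open>The rounds of the auction\<close>

text \<open>The limit serves as a sentinel: if \<open>bp\<close> stays at it, no copy is affordable
  and \<open>bq\<close> is meaningless.\<close>

definition cheapest :: prog where
  "cheapest = Set ''bp'' (Const 0) (Var ''L'') ;;
     For ''q'' ''d'' (Cond (And
         (Less (Const 0) (Cell ''g'' (Plus (Cell ''row'' (Var ''i'')) (Cell ''md'' (Var ''q'')))))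
         (Less (Cell ''p'' (Var ''q'')) (Var ''bp'')))
       (Set ''bp'' (Const 0) (Cell ''p'' (Var ''q'')) ;; Set ''bq'' (Const 0) (Var ''q'')) Nop)"

text \<open>The order of the writes matters: the old holder is read from \<open>sl\<close> before
  that entry is overwritten.\<close>

definition bid :: prog where
  "bid = Cond (And (Less (Cell ''t'' (Var ''i'')) (Const 1)) (And (Less (Cell ''c'' (Var ''i'')) (Const 1))
         (Less (Cell ''as'' (Plus (Var ''i'') (Const 1))) (Const 1))))
     (cheapest ;;
      Cond (Less (Var ''bp'') (Var ''L''))
        (Set ''as'' (Cell ''sl'' (Var ''bq'')) (Const 0) ;;
         Set ''sl'' (Var ''bq'') (Plus (Var ''i'') (Const 1)) ;;
         Set ''as'' (Plus (Var ''i'') (Const 1)) (Const 1) ;;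
         Set ''p'' (Var ''bq'') (Plus (Cell ''p'' (Var ''bq'')) (Const 1))) Nop)
     Nop"

definition auction :: prog where
  "auction = For ''z'' ''r'' (For ''i'' ''m'' bid)"

lemma writes_cheapest [simp]: "writes cheapest = {''q'', ''bp'', ''bq''}"
  by (auto simp: cheapest_def)

lemma writes_bid [simp]: "writes bid = {''q'', ''bp'', ''bq'', ''as'', ''sl'', ''p''}"
  by (auto simp: bid_def)

lemma run_cheapest:
  assumes ld: "loaded n E NT s" and i: "s ''i'' 0 = i" "i < n"
  defines "s' \<equiv> run cheapest s"
  shows "s' ''bp'' 0 \<le> Suc (2 * n)"
    and "\<And>q. q < 2 * n \<Longrightarrow> {i, q mod n} \<in> E \<Longrightarrow> s' ''bp'' 0 \<le> s ''p'' q"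
    and "s' ''bp'' 0 < Suc (2 * n) \<Longrightarrow>
      s' ''bq'' 0 < 2 * n \<and> {i, s' ''bq'' 0 mod n} \<in> E \<and> s ''p'' (s' ''bq'' 0) = s' ''bp'' 0"
proof -
  note L = loadedD[OF ld]
  let ?I = "\<lambda>k t. t ''bp'' 0 \<le> Suc (2 * n) \<and> (\<forall>q<k. {i, q mod n} \<in> E \<longrightarrow> t ''bp'' 0 \<le> s ''p'' q) \<and>
    (t ''bp'' 0 < Suc (2 * n) \<longrightarrow>
      t ''bq'' 0 < 2 * n \<and> {i, t ''bq'' 0 mod n} \<in> E \<and> s ''p'' (t ''bq'' 0) = t ''bp'' 0)"
  have "?I (2 * n) s'"
    unfolding s'_def cheapest_def run.simps(3)
  proof (rule run_For[where I = ?I])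
    fix k t
    assume k: "k < 2 * n" "t ''q'' 0 = k" and I: "?I k t"
      and fr: "\<And>x. x \<notin> insert ''q'' (writes (Cond (And
         (Less (Const 0) (Cell ''g'' (Plus (Cell ''row'' (Var ''i'')) (Cell ''md'' (Var ''q'')))))
         (Less (Cell ''p'' (Var ''q'')) (Var ''bp'')))
       (Set ''bp'' (Const 0) (Cell ''p'' (Var ''q'')) ;; Set ''bq'' (Const 0) (Var ''q'')) Nop)) \<Longrightarrow>
        t x = run (Set ''bp'' (Const 0) (Var ''L'')) s x"
    have fr': "t ''g'' = s ''g''" "t ''row'' = s ''row''" "t ''i'' 0 = i" "t ''md'' = s ''md''" "t ''p'' = s ''p''"
      using i by (simp_all add: fr)
    have "k mod n < n" using k(1) by (intro mod_less_divisor) auto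
    then have g: "s ''g'' (i * n + k mod n) = of_bool ({i, k mod n} \<in> E)"
      using L(7)[OF i(2)] by simp
    have row: "s ''row'' i = i * n" "s ''md'' k = k mod n" using L(6) L(9) i(2) k(1) by simp_all
    show "?I (Suc k) (update (run (Cond (And
         (Less (Const 0) (Cell ''g'' (Plus (Cell ''row'' (Var ''i'')) (Cell ''md'' (Var ''q'')))))
         (Less (Cell ''p'' (Var ''q'')) (Var ''bp'')))
       (Set ''bp'' (Const 0) (Cell ''p'' (Var ''q'')) ;; Set ''bq'' (Const 0) (Var ''q'')) Nop) t) ''q'' 0 (Suc k))"
      using I k(1) by (auto simp: fr' row g k(2) less_Suc_eq)
  qed (use L(2,3) in simp_all)
  then show "s' ''bp'' 0 \<le> Suc (2 * n)"
    "\<And>q. q < 2 * n \<Longrightarrow> {i, q mod n} \<in> E \<Longrightarrow> s' ''bp'' 0 \<le> s ''p'' q"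
    "s' ''bp'' 0 < Suc (2 * n) \<Longrightarrow>
      s' ''bq'' 0 < 2 * n \<and> {i, s' ''bq'' 0 mod n} \<in> E \<and> s ''p'' (s' ''bq'' 0) = s' ''bp'' 0"
    by blast+
qed

section \<open>Convergence of the auction, measured by the total price\<close>

definition auction_state :: "nat \<Rightarrow> nat set set \<Rightarrow> nat set \<Rightarrow> state \<Rightarrow> bool" where
  "auction_state n E I s \<longleftrightarrow>
     auction_inv (\<lambda>i q. {i, q mod n} \<in> E) I (2 * n) (Suc (2 * n)) (s ''p'') (s ''sl'') (s ''as'')"

text \<open>Under the auction invariant a price above \<open>2 * n\<close> is the limit itself, so a
  settled bidder makes no bid.\<close>

definition settled :: "nat \<Rightarrow> nat set set \<Rightarrow> nat set \<Rightarrow> state \<Rightarrow> nat \<Rightarrow> bool" where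
  "settled n E I s i \<longleftrightarrow>
     (i \<in> unassigned I (s ''as'') \<longrightarrow> (\<forall>q<2 * n. {i, q mod n} \<in> E \<longrightarrow> 2 * n < s ''p'' q))"

abbreviation total_price :: "nat \<Rightarrow> state \<Rightarrow> nat" where
  "total_price n s \<equiv> (\<Sum>q<2 * n. s ''p'' q)"

text \<open>The total price is a potential: a turn either leaves the auction as it is or raises one
  price by 1, and an eviction lowers none.\<close>

lemma run_bid:
  assumes ld: "loaded n E NT s" and i: "s ''i'' 0 = i" "i < n"
    and I: "\<And>v. v < n \<Longrightarrow> v \<in> I \<longleftrightarrow> v \<notin> NT \<and> s ''c'' v = 0"
    and inv: "auction_state n E I s"
  defines "s' \<equiv> run bid s"
  shows "auction_state n E I s'"
    and "if settled n E I s i then s' ''p'' = s ''p'' \<and> s' ''sl'' = s ''sl'' \<and> s' ''as'' = s ''as''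
      else total_price n s' = Suc (total_price n s)"
proof -
  note L = loadedD[OF ld]
  have t: "s ''t'' i = of_bool (i \<in> NT)" using L(8) i by simp
  have un: "i \<in> unassigned I (s ''as'') \<longleftrightarrow> i \<notin> NT \<and> s ''c'' i = 0 \<and> s ''as'' (Suc i) = 0"
    using I[OF i(2)] by (auto simp: unassigned_def)
  define u where "u = run cheapest s"
  have u: "u x = s x" if "x \<notin> {''q'', ''bp'', ''bq''}" for x
    unfolding u_def using that by (intro run_unwritten) simp
  have u': "u ''p'' = s ''p''" "u ''sl'' = s ''sl''" "u ''as'' = s ''as''" "u ''i'' = s ''i''" "u ''L'' = s ''L''"
    by (simp_all add: u)
  note C = run_cheapest[OF ld i, folded u_def]
  have "auction_state n E I s' \<and>
    (if settled n E I s i then s' ''p'' = s ''p'' \<and> s' ''sl'' = s ''sl'' \<and> s' ''as'' = s ''as''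
      else total_price n s' = Suc (total_price n s))"
  proof (cases "i \<in> unassigned I (s ''as'')")
    case False
    then have "s' = s" unfolding s'_def bid_def using un t i by (auto split: if_splits)
    moreover have "settled n E I s i" using False by (simp add: settled_def)
    ultimately show ?thesis using inv by simp
  next
    case True
    then have s': "s' = run (Cond (Less (Var ''bp'') (Var ''L''))
        (Set ''as'' (Cell ''sl'' (Var ''bq'')) (Const 0) ;;
         Set ''sl'' (Var ''bq'') (Plus (Var ''i'') (Const 1)) ;;
         Set ''as'' (Plus (Var ''i'') (Const 1)) (Const 1) ;;
         Set ''p'' (Var ''bq'') (Plus (Cell ''p'' (Var ''bq'')) (Const 1))) Nop) u"
      unfolding s'_def bid_def using un t i by (simp add: u_def)
    show ?thesis
    proof (cases "u ''bp'' 0 < Suc (2 * n)")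
      case False
      then have "settled n E I s i"
        using C(1,2) by (fastforce simp: settled_def)
      moreover have "s' = u" using False L(3) by (simp add: s' u')
      ultimately show ?thesis using inv by (simp add: auction_state_def u')
    next
      case bp: True
      define b where "b = u ''bq'' 0"
      have b: "b < 2 * n" "{i, b mod n} \<in> E" "s ''p'' b < Suc (2 * n)"
        using C(3)[OF bp] bp by (auto simp: b_def)
      have min: "s ''p'' b \<le> s ''p'' q" if "q < 2 * n" "{i, q mod n} \<in> E" for q
        using C(2)[OF that] C(3)[OF bp] by (simp add: b_def)
      have arr: "s' ''p'' = (s ''p'')(b := Suc (s ''p'' b))" "s' ''sl'' = (s ''sl'')(b := Suc i)"
        "s' ''as'' = (s ''as'')(s ''sl'' b := 0, Suc i := 1)"
        using bp L(3) i(1) by (simp_all add: s' u' b_def)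
      have "auction_state n E I s'"
        unfolding auction_state_def arr
        by (rule auction_bid[OF inv[unfolded auction_state_def]])
          (use True b min in \<open>auto simp: unassigned_def\<close>)
      moreover have "\<not> settled n E I s i"
        using True b by (auto simp: settled_def)
      moreover have "total_price n s' = Suc (total_price n s)"
        unfolding arr using b(1) by (simp add: sum.remove[of _ b])
      ultimately show ?thesis by simp
    qed
  qed
  then show "auction_state n E I s'"
    "if settled n E I s i then s' ''p'' = s ''p'' \<and> s' ''sl'' = s ''sl'' \<and> s' ''as'' = s ''as''
      else total_price n s' = Suc (total_price n s)" by simp_all
qed

text \<open>If nobody bids, every bidder has met the prices from the start of the round and is
  settled with respect to them; otherwise the potential has grown.\<close>

lemma run_round:
  assumes ld: "loaded n E NT s"
    and I: "\<And>v. v < n \<Longrightarrow> v \<in> I \<longleftrightarrow> v \<notin> NT \<and> s ''c'' v = 0"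
    and inv: "auction_state n E I s"
  defines "s' \<equiv> run (For ''i'' ''m'' bid) s"
  shows "auction_state n E I s'"
    and "(\<forall>i<n. settled n E I s' i) \<or> total_price n s < total_price n s'"
    and "\<forall>i<n. settled n E I s i \<Longrightarrow> \<forall>i<n. settled n E I s' i"
proof -
  let ?same = "\<lambda>t. t ''p'' = s ''p'' \<and> t ''sl'' = s ''sl'' \<and> t ''as'' = s ''as''"
  \<comment> \<open>The last conjunct records that a bid presupposes somebody unsettled at the
    start, which yields the third claim.\<close>
  let ?J = "\<lambda>k t. auction_state n E I t \<and>
    (?same t \<and> (\<forall>i<k. settled n E I s i) \<or> total_price n s < total_price n t \<and> (\<exists>i<n. \<not> settled n E I s i))"
  have J: "?J n s'"
    unfolding s'_def
  proof (rule run_For[where I = ?J])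
    fix k t
    assume k: "k < n" "t ''i'' 0 = k" and fr: "\<And>x. x \<notin> insert ''i'' (writes bid) \<Longrightarrow> t x = s x"
      and J: "?J k t"
    have ldt: "loaded n E NT t"
      using ld by (rule loaded_cong) (auto intro!: fr)
    have It: "\<And>v. v < n \<Longrightarrow> v \<in> I \<longleftrightarrow> v \<notin> NT \<and> t ''c'' v = 0" using I fr by simp
    note B = run_bid[OF ldt k(2,1) It conjunct1[OF J]]
    let ?t' = "update (run bid t) ''i'' 0 (Suc k)"
    have st: "auction_state n E I ?t'" using B(1) by (simp add: auction_state_def)
    have "?same ?t' \<and> (\<forall>i<Suc k. settled n E I s i) \<or>
        total_price n s < total_price n ?t' \<and> (\<exists>i<n. \<not> settled n E I s i)"
    proof (cases "settled n E I t k")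
      case True
      then have eq: "?t' ''p'' = t ''p''" "?t' ''sl'' = t ''sl''" "?t' ''as'' = t ''as''"
        using B(2) by simp_all
      show ?thesis
        using J
      proof (elim conjE disjE)
        assume same: "t ''p'' = s ''p''" "t ''sl'' = s ''sl''" "t ''as'' = s ''as''"
          and less: "\<forall>i<k. settled n E I s i"
        have "settled n E I s k" using True by (simp add: settled_def same)
        then show ?thesis using less same eq by (simp add: less_Suc_eq)
      next
        assume "total_price n s < total_price n t" "\<exists>i<n. \<not> settled n E I s i"
        then show ?thesis unfolding eq by simp
      qed
    next
      case False
      then have inc: "total_price n ?t' = Suc (total_price n t)" using B(2) by simp
      show ?thesis
        using J
      proof (elim conjE disjE)
        assume same: "t ''p'' = s ''p''" "t ''sl'' = s ''sl''" "t ''as'' = s ''as''"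
        have "\<not> settled n E I s k" using False by (simp add: settled_def same)
        then show ?thesis using inc k(1) unfolding same by auto
      next
        assume "total_price n s < total_price n t" "\<exists>i<n. \<not> settled n E I s i"
        then show ?thesis unfolding inc by simp
      qed
    qed
    with st show "?J (Suc k) ?t'" by simp
  qed (use inv loadedD(1)[OF ld] in \<open>simp_all add: auction_state_def\<close>)
  then show "auction_state n E I s'" by simp
  from J show "(\<forall>i<n. settled n E I s' i) \<or> total_price n s < total_price n s'"
    and "\<forall>i<n. settled n E I s i \<Longrightarrow> \<forall>i<n. settled n E I s' i"
    by (auto simp: settled_def)
qed

text \<open>A round that does not end with everybody settled raises the total price, which is at
  most \<open>2 * n * (2 * n + 1)\<close>; there is one more round than that.\<close>

lemma run_auction:
  assumes ld: "loaded n E NT s"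
    and I: "\<And>v. v < n \<Longrightarrow> v \<in> I \<longleftrightarrow> v \<notin> NT \<and> s ''c'' v = 0"
    and init: "s ''p'' = (\<lambda>_. 0)" "s ''sl'' = (\<lambda>_. 0)" "s ''as'' = (\<lambda>_. 0)"
  defines "s' \<equiv> run auction s"
  shows "auction_state n E I s'" and "\<forall>i<n. settled n E I s' i"
proof -
  let ?J = "\<lambda>k t. auction_state n E I t \<and> ((\<forall>i<n. settled n E I t i) \<or> k \<le> total_price n t)"
  let ?r = "Suc (2 * n * Suc (2 * n))"
  have J: "?J ?r s'"
    unfolding s'_def auction_def
  proof (rule run_For[where I = ?J])
    show "?J 0 (update s ''z'' 0 0)"
      using init auction_inv_init by (simp add: auction_state_def)
  next
    fix k t
    assume k: "t ''z'' 0 = k" and J: "?J k t"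
      and fr: "\<And>x. x \<notin> insert ''z'' (writes (For ''i'' ''m'' bid)) \<Longrightarrow> t x = s x"
    have ldt: "loaded n E NT t"
      using ld by (rule loaded_cong) (auto intro!: fr)
    have It: "\<And>v. v < n \<Longrightarrow> v \<in> I \<longleftrightarrow> v \<notin> NT \<and> t ''c'' v = 0" using I fr by simp
    note R = run_round[OF ldt It conjunct1[OF J]]
    let ?t = "run (For ''i'' ''m'' bid) t"
    let ?t' = "update ?t ''z'' 0 (Suc k)"
    have eq: "?t' ''p'' = ?t ''p''" "?t' ''sl'' = ?t ''sl''" "?t' ''as'' = ?t ''as''"
      by (simp_all del: run.simps)
    have "(\<forall>i<n. settled n E I ?t i) \<or> Suc k \<le> total_price n ?t"
      using R(2,3) J by auto
    then show "?J (Suc k) ?t'"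
      using R(1) unfolding auction_state_def settled_def eq by simp
  qed (use loadedD(5)[OF ld] in simp_all)
  have "total_price n s' \<le> of_nat (card {..<2 * n}) * Suc (2 * n)"
    using J auction_invD(1) by (intro sum_bounded_above) (auto simp: auction_state_def)
  then show "auction_state n E I s'" "\<forall>i<n. settled n E I s' i"
    using J by auto
qed

subsection \<open>Relabelling and output\<close>

text \<open>Labels are handed out in increasing order, so that the reduced graph lives on an initial
  segment, as the output format demands.\<close>

definition relabel :: prog where
  "relabel = For ''i'' ''m'' (Cond (And (Less (Cell ''t'' (Var ''i'')) (Const 1))
       (And (Less (Cell ''c'' (Var ''i'')) (Const 1))
         (Less (Cell ''as'' (Plus (Var ''i'') (Const 1))) (Const 1))))
     (Cond (Less (Var ''rep'') (Const 1))
       (Set ''rep'' (Const 0) (Plus (Var ''k'') (Const 1)) ;; Set ''f'' (Var ''i'') (Var ''k'') ;;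
        Set ''k'' (Const 0) (Plus (Var ''k'') (Const 1)))
       (Set ''f'' (Var ''i'') (Monus (Var ''rep'') (Const 1))))
     (Set ''f'' (Var ''i'') (Var ''k'') ;; Set ''k'' (Const 0) (Plus (Var ''k'') (Const 1))))"

text \<open>The common label of the vertices of \<open>U\<close> is \<open>rep - 1\<close>, and \<open>rep = 0\<close> as long as none of
  them has been met.\<close>

definition relabel_inv :: "nat set \<Rightarrow> nat \<Rightarrow> (nat \<Rightarrow> nat) \<Rightarrow> nat \<Rightarrow> nat \<Rightarrow> bool" where
  "relabel_inv U v f k rep \<longleftrightarrow> f ` {..<v} = {..<k} \<and>
     (\<forall>x<v. \<forall>y<v. f x = f y \<longleftrightarrow> x = y \<or> x \<in> U \<and> y \<in> U) \<and>
     (rep = 0 \<longrightarrow> (\<forall>u<v. u \<notin> U)) \<and> (rep \<noteq> 0 \<longrightarrow> (\<exists>u<v. u \<in> U \<and> rep = Suc (f u)))"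

lemma relabel_inv_new:
  assumes inv: "relabel_inv U v f k rep" and v: "v \<in> U \<Longrightarrow> rep = 0"
  shows "relabel_inv U (Suc v) (f(v := k)) (Suc k) (if v \<in> U then Suc k else rep)"
proof -
  have im: "f ` {..<v} = {..<k}" using inv by (simp add: relabel_inv_def)
  then have lt: "f x < k" if "x < v" for x using that by blast
  have "(f(v := k)) ` {..<Suc v} = insert k (f ` {..<v})"
    by (auto simp: lessThan_Suc)
  then have "(f(v := k)) ` {..<Suc v} = {..<Suc k}" unfolding im by (simp add: lessThan_Suc)
  moreover have "(f(v := k)) x = (f(v := k)) y \<longleftrightarrow> x = y \<or> x \<in> U \<and> y \<in> U"
    if "x < Suc v" "y < Suc v" for x y
    using that inv v lt[of x] lt[of y] by (auto simp: relabel_inv_def less_Suc_eq)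
  moreover have "\<exists>u<Suc v. u \<in> U \<and> rep = Suc ((f(v := k)) u)" if r: "v \<notin> U" "rep \<noteq> 0"
  proof -
    obtain u where "u < v" "u \<in> U" "rep = Suc (f u)" using inv r by (auto simp: relabel_inv_def)
    then show ?thesis by (intro exI[of _ u]) simp
  qed
  moreover have "u \<notin> U" if "v \<notin> U" "rep = 0" "u < Suc v" for u
    using that inv by (auto simp: relabel_inv_def less_Suc_eq)
  ultimately show ?thesis unfolding relabel_inv_def by (simp split: if_split) blast
qed

lemma relabel_inv_old:
  assumes inv: "relabel_inv U v f k rep" and v: "v \<in> U" "rep \<noteq> 0"
  shows "relabel_inv U (Suc v) (f(v := rep - 1)) k rep"
proof -
  obtain u where u: "u < v" "u \<in> U" "rep = Suc (f u)" using inv v by (auto simp: relabel_inv_def)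
  have f: "f x = f y \<longleftrightarrow> x = y \<or> x \<in> U \<and> y \<in> U" if "x < v" "y < v" for x y
    using inv that by (auto simp: relabel_inv_def)
  have "(f(v := rep - 1)) ` {..<Suc v} = f ` {..<v}"
    using u by (auto simp: lessThan_Suc)
  moreover have "(f(v := rep - 1)) x = (f(v := rep - 1)) y \<longleftrightarrow> x = y \<or> x \<in> U \<and> y \<in> U"
    if "x < Suc v" "y < Suc v" for x y
    using that u v(1) f[of x y] f[of u y] f[of x u] by (auto simp: less_Suc_eq)
  moreover have "\<exists>u<Suc v. u \<in> U \<and> rep = Suc ((f(v := rep - 1)) u)"
    using u by (intro exI[of _ u]) simp
  ultimately show ?thesis using inv v by (simp add: relabel_inv_def)
qed

lemma run_relabel:
  assumes ld: "loaded n E NT s"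
    and U: "\<And>v. v < n \<Longrightarrow> v \<in> U \<longleftrightarrow> v \<notin> NT \<and> s ''c'' v = 0 \<and> s ''as'' (Suc v) = 0"
    and init: "s ''k'' 0 = 0" "s ''rep'' 0 = 0"
  defines "s' \<equiv> run relabel s"
  shows "relabel_inv U n (s' ''f'') (s' ''k'' 0) (s' ''rep'' 0)"
  unfolding s'_def relabel_def
proof (rule run_For[where I = "\<lambda>v t. relabel_inv U v (t ''f'') (t ''k'' 0) (t ''rep'' 0)"], goal_cases)
  case (5 v t)
  note fr = 5(3)
  have arr: "t ''t'' = s ''t''" "t ''c'' = s ''c''" "t ''as'' = s ''as''" by (simp_all add: fr)
  have t: "s ''t'' v = of_bool (v \<in> NT)" using loadedD(8)[OF ld] 5(1) by simp
  show ?case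
  proof (cases "v \<in> U \<and> t ''rep'' 0 \<noteq> 0")
    case True
    then show ?thesis using relabel_inv_old[OF 5(4)] U[OF 5(1)] by (simp add: 5(2) arr t)
  next
    case False
    then have "relabel_inv U (Suc v) ((t ''f'')(v := t ''k'' 0)) (Suc (t ''k'' 0))
        (if v \<in> U then Suc (t ''k'' 0) else t ''rep'' 0)"
      by (intro relabel_inv_new[OF 5(4)]) simp
    then show ?thesis using False U[OF 5(1)] by (auto simp: 5(2) arr t split: if_splits)
  qed
qed (use init loadedD(1)[OF ld] in \<open>auto simp: relabel_inv_def\<close>)

section \<open>Writing the reduced graph\<close>

definition edge_body :: prog where
  "edge_body = Cond (Less (Const 0) (Cell ''g'' (Plus (Cell ''row'' (Var ''i'')) (Var ''j''))))
     (Set ''adj'' (Plus (Cell ''ro'' (Cell ''f'' (Var ''i''))) (Cell ''f'' (Var ''j''))) (Const 1)) Nop"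

text \<open>Row offsets in the output matrix are multiples of \<open>k\<close>. As \<open>k\<close>
  is written by the same program, \<open>exec_code\<close> does not admit it as a limit; the loop
  runs up to \<open>n\<close> instead, which suffices by \<open>k \<le> n\<close>.\<close>

definition output_rows :: prog where
  "output_rows = For ''i'' ''m'' (Set ''ro'' (Plus (Var ''i'') (Const 1))
     (Plus (Cell ''ro'' (Var ''i'')) (Var ''k'')))"

definition output_nt :: prog where
  "output_nt = For ''i'' ''m''
     (Cond (Less (Const 0) (Cell ''t'' (Var ''i''))) (Set ''nt'' (Cell ''f'' (Var ''i'')) (Const 1)) Nop)"

definition output_adj :: prog where
  "output_adj = For ''i'' ''m'' (For ''j'' ''m'' edge_body)"

lemma run_output_rows:
  assumes ld: "loaded n E NT s" and init: "s ''ro'' 0 = 0"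
  shows "\<forall>i\<le>n. run output_rows s ''ro'' i = i * s ''k'' 0"
  unfolding output_rows_def
  by (rule run_For[where I = "\<lambda>v t. \<forall>i\<le>v. t ''ro'' i = i * s ''k'' 0"])
    (use init loadedD(1)[OF ld] in \<open>auto simp: le_Suc_eq\<close>)

lemma run_output_nt:
  assumes ld: "loaded n E NT s" and init: "\<And>i. i < n \<Longrightarrow> s ''nt'' i = 0" and NT: "NT \<subseteq> {..<n}"
  shows "\<forall>a<n. run output_nt s ''nt'' a = of_bool (a \<in> s ''f'' ` NT)"
proof -
  have "\<forall>a<n. run output_nt s ''nt'' a = of_bool (a \<in> s ''f'' ` (NT \<inter> {..<n}))"
    unfolding output_nt_def
  proof (rule run_For[where I = "\<lambda>v t. \<forall>a<n. t ''nt'' a = of_bool (a \<in> s ''f'' ` (NT \<inter> {..<v}))"],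
      goal_cases)
    case (5 v t)
    note fr = 5(3)
    have arr: "t ''t'' = s ''t''" "t ''f'' = s ''f''" by (simp_all add: fr)
    have t: "s ''t'' v = of_bool (v \<in> NT)" using loadedD(8)[OF ld] 5(1) by simp
    show ?case using 5(4) by (auto simp: 5(2) arr t lessThan_Suc)
  qed (use init loadedD(1)[OF ld] in auto)
  moreover have "NT \<inter> {..<n} = NT" using NT by blast
  ultimately show ?thesis by simp
qed

text \<open>\<open>P D\<close> describes the cells hit by images of edges among the ordered pairs in
  \<open>D\<close>. Cells are only ever set to 1, so several edges with the same image do no
  harm.\<close>

lemma run_output_adj:
  assumes ld: "loaded n E NT s" and init: "\<And>z. z < n * n \<Longrightarrow> s ''adj'' z = 0"
    and f: "\<And>i. i < n \<Longrightarrow> s ''f'' i < k" and k: "k \<le> n" and ro: "\<forall>i\<le>n. s ''ro'' i = i * k"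
  defines "P \<equiv> \<lambda>D z. \<exists>(i, j)\<in>D. {i, j} \<in> E \<and> z = s ''f'' i * k + s ''f'' j"
  shows "\<forall>z<n * n. run output_adj s ''adj'' z = of_bool (P ({..<n} \<times> {..<n}) z)"
  unfolding output_adj_def
proof (rule run_For[where I = "\<lambda>v t. \<forall>z<n * n. t ''adj'' z = of_bool (P ({..<v} \<times> {..<n}) z)"],
    goal_cases)
  case (5 v t)
  note fr = 5(3)
  have ldt: "loaded n E NT t"
    using ld by (rule loaded_cong) (auto intro!: fr simp: edge_body_def)
  let ?u = "run (For ''j'' ''m'' edge_body) t"
  have "\<forall>z<n * n. ?u ''adj'' z = of_bool (P ({..<v} \<times> {..<n} \<union> {v} \<times> {..<n}) z)"
  proof (rule run_For[where I = "\<lambda>w u. \<forall>z<n * n. u ''adj'' z =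
        of_bool (P ({..<v} \<times> {..<n} \<union> {v} \<times> {..<w}) z)"])
    show "\<forall>z<n * n. update t ''j'' 0 0 ''adj'' z = of_bool (P ({..<v} \<times> {..<n} \<union> {v} \<times> {..<0}) z)"
      using 5(4) by simp
  next
    fix w u
    assume w: "w < n" "u ''j'' 0 = w"
      and fr': "\<And>x. x \<notin> insert ''j'' (writes edge_body) \<Longrightarrow> u x = t x"
      and inv: "\<forall>z<n * n. u ''adj'' z = of_bool (P ({..<v} \<times> {..<n} \<union> {v} \<times> {..<w}) z)"
    have "loaded n E NT u"
      using ldt by (rule loaded_cong) (auto intro!: fr' simp: edge_body_def)
    note L = loadedD[OF this]
    have i: "u ''i'' 0 = v" using 5(2) by (simp add: fr' edge_body_def)
    have arr: "u ''f'' = s ''f''" "u ''ro'' = s ''ro''" by (simp_all add: fr fr' edge_body_def)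
    have g: "u ''g'' (v * n + w) = of_bool ({v, w} \<in> E)" using L(7) 5(1) w by simp
    have row: "u ''row'' v = v * n" using L(6) 5(1) by simp
    have "s ''f'' v \<le> n" using f[OF 5(1)] k by simp
    then have rof: "s ''ro'' (s ''f'' v) = s ''f'' v * k" using ro by simp
    have D: "{..<v} \<times> {..<n} \<union> {v} \<times> {..<Suc w} = insert (v, w) ({..<v} \<times> {..<n} \<union> {v} \<times> {..<w})"
      by auto
    have P: "P (insert (v, w) D) z \<longleftrightarrow> {v, w} \<in> E \<and> z = s ''f'' v * k + s ''f'' w \<or> P D z" for D z
      by (auto simp: P_def)
    show "\<forall>z<n * n. update (run edge_body u) ''j'' 0 (Suc w) ''adj'' z =
        of_bool (P ({..<v} \<times> {..<n} \<union> {v} \<times> {..<Suc w}) z)"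
      unfolding D P using inv by (simp add: edge_body_def i w(2) g row arr rof)
  qed (use loadedD(1)[OF ldt] in \<open>simp_all add: edge_body_def\<close>)
  moreover have "{..<v} \<times> {..<n} \<union> {v} \<times> {..<n} = {..<Suc v} \<times> {..<n}" by auto
  ultimately show ?case by (simp del: run.simps(5))
qed (use init loadedD(1)[OF ld] in \<open>simp_all add: edge_body_def P_def\<close>)

text \<open>If the graph is still large, then the answer is no, and the program outputs the path
  on three vertices whose end vertex 0 must not be a leaf.\<close>

definition finish :: prog where
  "finish = Set ''n'' (Const 0) (Var ''k'') ;;
     Cond (Less (Plus (Plus (Plus (Var ''xc'') (Var ''xc'')) (Plus (Var ''xc'') (Var ''xc''))) (Const 2)) (Var ''k''))
       (Set ''n'' (Const 0) (Const 3) ;;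
        Set ''adj'' (Const 0) (Const 0) ;; Set ''adj'' (Const 1) (Const 1) ;; Set ''adj'' (Const 2) (Const 0) ;;
        Set ''adj'' (Const 3) (Const 1) ;; Set ''adj'' (Const 4) (Const 0) ;; Set ''adj'' (Const 5) (Const 1) ;;
        Set ''adj'' (Const 6) (Const 0) ;; Set ''adj'' (Const 7) (Const 1) ;; Set ''adj'' (Const 8) (Const 0) ;;
        Set ''nt'' (Const 0) (Const 1) ;; Set ''nt'' (Const 1) (Const 0) ;; Set ''nt'' (Const 2) (Const 0))
       Nop"

section \<open>A fixed no-instance\<close>

abbreviation path3 :: "nat set set" where
  "path3 \<equiv> {{0, 1}, {1, 2}}"

lemma ntst_instance_path3: "ntst_instance {..<3} path3 {0}"
proof -
  have three: "{..<3} = {0, 1, 2 :: nat}" by auto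
  have "reach path3 0 1" "reach path3 2 1"
    by (auto intro!: reach_edge simp: insert_commute)
  then have 1: "reach path3 u 1" if "u \<in> {..<3}" for u
    using that unfolding three by auto
  have "graph_connected {..<3} path3"
    unfolding graph_connected_reach
    using reach_trans[OF 1 reach_sym[OF 1]] by (auto simp: three)
  then show ?thesis by (auto simp: ntst_instance_def ugraph_def)
qed

lemma not_ntst_yes_path3: "\<not> ntst_yes {..<3} path3 {0}"
proof
  assume "ntst_yes {..<3} path3 {0}"
  then obtain T where T: "T \<subseteq> path3" "2 \<le> degree_in T 0"
    by (auto simp: ntst_yes_def spanning_tree_def)
  have "e = {0, 1}" if "e \<in> T" "0 \<in> e" for e
  proof -
    have "e = {0, 1} \<or> e = {1, 2}" using that(1) T(1) by blast
    then show ?thesis using that(2) by (elim disjE) simp_all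
  qed
  then have "{e \<in> T. 0 \<in> e} \<subseteq> {{0, 1}}" by (simp add: subset_iff)
  then have "degree_in T 0 \<le> card {{0 :: nat, 1}}"
    unfolding degree_in_def by (intro card_mono) auto
  then show False using T(2) by simp
qed

lemma represents_no_instance:
  assumes "4 * s ''xc'' 0 + 2 < s ''k'' 0"
  shows "represents (run finish s) 3 path3 {0}"
proof -
  have nine: "(\<forall>i<9. P i) \<longleftrightarrow> P 0 \<and> P 1 \<and> P 2 \<and> P 3 \<and> P 4 \<and> P 5 \<and> P 6 \<and> P 7 \<and> P (8 :: nat)" for P
    by (auto simp: eval_nat_numeral All_less_Suc)
  have three: "(\<forall>i<3. P i) \<longleftrightarrow> P 0 \<and> P 1 \<and> P (2 :: nat)" for P
    by (auto simp: eval_nat_numeral All_less_Suc)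
  show ?thesis
    unfolding represents_def
    using assms by (simp add: finish_def encode_def nine three doubleton_eq_iff)
qed

text \<open>As \<open>f j < k\<close>, division by \<open>k\<close> recovers both labels from the
  cell number. An image edge is unordered, but both orders of its ends are among the pairs
  \<open>(i, j)\<close>.\<close>

lemma represents_relabelled:
  assumes small: "s ''k'' 0 \<le> 4 * s ''xc'' 0 + 2"
    and k: "s ''k'' 0 = k" and E: "ugraph {..<n} E" and f: "\<And>i. i < n \<Longrightarrow> f i < k"
    and adj: "\<And>z. z < k * k \<Longrightarrow>
      s ''adj'' z = of_bool (\<exists>(i, j)\<in>{..<n} \<times> {..<n}. {i, j} \<in> E \<and> z = f i * k + f j)"
    and nt: "\<And>a. a < k \<Longrightarrow> s ''nt'' a = of_bool (a \<in> f ` NT)"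
  shows "represents (run finish s) k ((`) f ` E) (f ` NT)"
proof -
  have fin: "run finish s = update s ''n'' 0 k"
    using small by (simp add: finish_def k del: update_row) (simp add: k)
  have "(\<exists>(i, j)\<in>{..<n} \<times> {..<n}. {i, j} \<in> E \<and> z = f i * k + f j) \<longleftrightarrow>
      {z div k, z mod k} \<in> (`) f ` E" if z: "z < k * k" for z
  proof
    assume "\<exists>(i, j)\<in>{..<n} \<times> {..<n}. {i, j} \<in> E \<and> z = f i * k + f j"
    then obtain i j where ij: "j < n" "{i, j} \<in> E" "z = f i * k + f j" by auto
    then have "z div k = f i" "z mod k = f j" using f[of j] by simp_all
    then show "{z div k, z mod k} \<in> (`) f ` E" using ij edge_image_iff[OF E] by metis
  next
    assume "{z div k, z mod k} \<in> (`) f ` E"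
    from iffD1[OF edge_image_iff[OF E] this]
    obtain a b where ab: "{a, b} \<in> E" "{z div k, z mod k} = {f a, f b}" by auto
    then have "z div k = f a \<and> z mod k = f b \<or> z div k = f b \<and> z mod k = f a" "{b, a} \<in> E"
      by (auto simp: doubleton_eq_iff insert_commute)
    with ab(1) obtain i j where ij: "{i, j} \<in> E" "z div k = f i" "z mod k = f j" by metis
    then have "z = f i * k + f j" using div_mult_mod_eq[of z k] by simp
    moreover have "i < n" "j < n" using ij(1) E by (auto simp: ugraph_def)
    ultimately show "\<exists>(i, j)\<in>{..<n} \<times> {..<n}. {i, j} \<in> E \<and> z = f i * k + f j"
      using ij(1) by auto
  qed
  then show ?thesis
    unfolding represents_def fin using adj nt by (simp add: encode_def)
qed

section \<open>The kernel\<close>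

text \<open>Program and combinatorics meet here: the final arrays enter as plain functions with
  their invariants. A cover number of at least 1 leaves room for the three vertices of the fixed
  no-instance.\<close>

lemma kernel_correct:
  fixes f c as p sl :: "nat \<Rightarrow> nat"
  assumes inst: "ntst_instance {..<n} E NT"
    and cov: "cover_inv E n c xc ({..<n} \<times> {..<n})"
    and I: "I = {v. v < n \<and> v \<notin> NT \<and> c v = 0}"
    and inv: "auction_inv (\<lambda>i q. {i, q mod n} \<in> E) I (2 * n) (Suc (2 * n)) p sl as"
    and stable: "\<forall>i\<in>unassigned I as. \<forall>q<2 * n. {i, q mod n} \<in> E \<longrightarrow> 2 * n < p q"
    and f: "relabel_inv (unassigned I as) n f k rep"
  shows "ntst_instance {..<k} ((`) f ` E) (f ` NT)"
    and "ntst_yes {..<k} ((`) f ` E) (f ` NT) \<longleftrightarrow> ntst_yes {..<n} E NT"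
    and "k \<le> n" and "ntst_yes {..<n} E NT \<Longrightarrow> k \<le> 4 * xc + 2"
    and "xc \<le> 2 * vc {..<n} E" and "1 \<le> vc {..<n} E"
proof -
  have ug: "ugraph {..<n} E" and con: "graph_connected {..<n} E" and NT: "NT \<subseteq> {..<n}" "card NT + 2 \<le> n"
    using inst by (auto simp: ntst_instance_def)
  have EV: "i < n" "j < n" "i \<noteq> j" if "{i, j} \<in> E" for i j
    using ug that by (fastforce simp: ugraph_def)+
  define X where "X = {v. c v \<noteq> 0}"
  define U where "U = unassigned I as"
  have X: "X \<subseteq> {..<n}" "xc = card X"
    and XC: "\<And>C. vertex_cover {..<n} E C \<Longrightarrow> xc \<le> 2 * card (C \<inter> X)"
    using cov[unfolded cover_inv_def, folded X_def] by blast+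
  have cover: "i \<in> X \<or> j \<in> X" if "{i, j} \<in> E" for i j
  proof -
    have "case (i, j) of (i, j) \<Rightarrow> {i, j} \<in> E \<longrightarrow> c i \<noteq> 0 \<or> c j \<noteq> 0"
      by (rule bspec[of "{..<n} \<times> {..<n}"]) (use cov EV[OF that] in \<open>simp_all add: cover_inv_def\<close>)
    then show ?thesis using that by (simp add: X_def)
  qed
  have finX: "finite X" using X(1) finite_subset by blast
  have nbr: "\<exists>x<n. {i, x} \<in> E" if i: "i < n" for i
  proof -
    obtain j where j: "j < n" "j \<noteq> i" using NT(2) i by (metis One_nat_def Suc_1 add_leD2 lessI
          less_le_trans not_less_eq zero_less_Suc less_irrefl)
    then have "reach E i j" using con i by (simp add: graph_connected_reach)
    then obtain e where e: "e \<in> E" "i \<in> e" using reach_isolated[of E i j] j(2) by meson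
    then have "card e = 2" using ug by (simp add: ugraph_def)
    with e(2) obtain x where "e = {i, x}" by (auto simp: card_2_iff)
    then show ?thesis using e(1) EV by blast
  qed
  obtain x0 where x0: "{0, x0} \<in> E" using nbr[of 0] NT(2) by auto
  have Xne: "X \<noteq> {}" using cover[OF x0] by auto
  have VX: "vertex_cover {..<n} E X"
    unfolding vertex_cover_def
  proof (intro conjI ballI)
    fix e assume e: "e \<in> E"
    then have "card e = 2" using ug by (simp add: ugraph_def)
    then obtain a b where "e = {a, b}" by (auto simp: card_2_iff)
    then show "e \<inter> X \<noteq> {}" using cover[of a b] e by auto
  qed (use X(1) in simp)
  then have "\<exists>m. \<exists>C. vertex_cover {..<n} E C \<and> card C = m" by blast
  then have "\<exists>C. vertex_cover {..<n} E C \<and> card C = vc {..<n} E"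
    unfolding vc_def by (rule LeastI_ex)
  then obtain C where C: "vertex_cover {..<n} E C" "card C = vc {..<n} E" by blast
  have finC: "finite C" using C(1) finite_subset by (auto simp: vertex_cover_def)
  have "card (C \<inter> X) \<le> card C" using finC by (intro card_mono) auto
  then show "xc \<le> 2 * vc {..<n} E" using XC[OF C(1)] C(2) by simp
  have "C \<noteq> {}" using C(1) x0 by (auto simp: vertex_cover_def)
  then show "1 \<le> vc {..<n} E" using C(2) finC by (metis One_nat_def Suc_leI card_gt_0_iff)

  have fim: "f ` {..<n} = {..<k}" using f by (simp add: relabel_inv_def)
  have feq: "f x = f y \<longleftrightarrow> x = y \<or> x \<in> U \<and> y \<in> U" if "x < n" "y < n" for x y
    using f that by (simp add: relabel_inv_def U_def)
  have UI: "U \<subseteq> I" by (auto simp: U_def unassigned_def)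
  have IX: "I \<subseteq> {..<n}" "I \<inter> X = {}" "I \<inter> NT = {}" by (auto simp: I X_def)
  \<comment> \<open>Bidders lie outside the cover \<open>X\<close>, so all their neighbours lie in
    it.\<close>
  have AX: "x \<in> X" if "i \<in> I" "{i, x} \<in> E" for i x
    using cover[OF that(2)] that(1) IX by auto
  have nbr': "\<exists>x<n. {i, x} \<in> E" if "i \<in> I" for i
    using nbr that IX by auto
  obtain R l0 l1 where "R \<subseteq> {..<n}"
    and inj: "inj_on l0 R" "inj_on l1 R" "l0 ` R \<inter> l1 ` R = {}"
    and l0: "\<And>x. x \<in> R \<Longrightarrow> l0 x \<in> I - U \<and> {l0 x, x} \<in> E"
    and l1: "\<And>x. x \<in> R \<Longrightarrow> l1 x \<in> I - U \<and> {l1 x, x} \<in> E"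
    and R: "\<And>i x. i \<in> l0 ` R \<union> l1 ` R \<union> U \<Longrightarrow> x < n \<Longrightarrow> {i, x} \<in> E \<Longrightarrow> x \<in> R"
  proof (rule unassigned_crown[OF inv, folded U_def])
    show "\<exists>x<n. {i, x} \<in> E" if "i \<in> I" for i by (rule nbr'[OF that])
    show "2 * n < p q" if "i \<in> U" "q < 2 * n" "{i, q mod n} \<in> E" for i q
      using stable that by (simp add: U_def)
  qed (rule that)
  have RX: "R \<subseteq> X" using l0 AX by blast
  have LI: "l0 ` R \<union> l1 ` R \<subseteq> I - U" using l0 l1 by blast
  have merge: "ntst_instance (f ` {..<n}) ((`) f ` E) (f ` NT)"
    "ntst_yes (f ` {..<n}) ((`) f ` E) (f ` NT) \<longleftrightarrow> ntst_yes {..<n} E NT"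
  proof (atomize (full), intro conjI)
    have U': "U \<subseteq> {..<n}" using UI IX by blast
    have edge: "{x, l0 x} \<in> E \<and> {x, l1 x} \<in> E" if "x \<in> R" for x
      using l0[OF that] l1[OF that] by (simp add: insert_commute)
    have nbhd: "v \<in> R" if "u \<in> l0 ` R \<union> l1 ` R \<union> U" "{u, v} \<in> E" for u v
      using R[OF that(1) EV(2)[OF that(2)] that(2)] .
    have disj: "R \<inter> (l0 ` R \<union> l1 ` R \<union> U) = {}" "(l0 ` R \<union> l1 ` R) \<inter> U = {}"
      "NT \<inter> (l0 ` R \<union> l1 ` R \<union> U) = {}"
      using RX LI UI IX by blast+
    have feq': "f x = f y \<longleftrightarrow> x = y \<or> x \<in> U \<and> y \<in> U" if "x \<in> {..<n}" "y \<in> {..<n}" for x y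
      using feq that by simp
    note M = ntst_merge[OF inst feq' U' inj edge nbhd disj]
    show "ntst_instance (f ` {..<n}) ((`) f ` E) (f ` NT)" by (rule M(1))
    show "ntst_yes (f ` {..<n}) ((`) f ` E) (f ` NT) \<longleftrightarrow> ntst_yes {..<n} E NT" by (rule M(2))
  qed
  then show "ntst_instance {..<k} ((`) f ` E) (f ` NT)"
    "ntst_yes {..<k} ((`) f ` E) (f ` NT) \<longleftrightarrow> ntst_yes {..<n} E NT"
    by (simp_all add: fim)
  have kcard: "k = card (f ` {..<n})" by (simp add: fim)
  also have "\<dots> \<le> n" using card_image_le[of "{..<n}" f] by simp
  finally show "k \<le> n" .

  assume yes: "ntst_yes {..<n} E NT"
  have INT: "card (NT - X) < card X" by (rule ntst_yes_card[OF inst yes VX Xne])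
  have fin: "finite (X \<union> (NT - X) \<union> (I - U))"
    using X(1) NT(1) IX(1) by (auto intro: finite_subset[of _ "{..<n}"])
  \<comment> \<open>All of \<open>U\<close> shares one label; the other three classes are counted by
    their sizes.\<close>
  have split: "{..<n} = X \<union> (NT - X) \<union> (I - U) \<union> U"
    using X(1) NT(1) IX(1) UI by (auto simp: I X_def)
  have "card (f ` U) \<le> 1"
  proof (cases "U = {}")
    case False
    then obtain u where u: "u \<in> U" by blast
    have "f w = f u" if "w \<in> U" for w using feq[of w u] that u UI IX(1) by blast
    then have "f ` U \<subseteq> {f u}" by blast
    then have "card (f ` U) \<le> card {f u}" by (intro card_mono) auto
    then show ?thesis by simp
  qed simp
  moreover have "k \<le> card (f ` (X \<union> (NT - X) \<union> (I - U))) + card (f ` U)"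
    unfolding kcard by (subst split, subst image_Un) (rule card_Un_le)
  moreover have "card (f ` (X \<union> (NT - X) \<union> (I - U))) \<le> card (X \<union> (NT - X) \<union> (I - U))"
    using fin by (intro card_image_le)
  moreover have "card (X \<union> (NT - X) \<union> (I - U)) \<le> card X + card (NT - X) + card (I - U)"
    by (meson add_le_mono1 card_Un_le order_trans)
  moreover have "card (I - U) \<le> 2 * card X"
    unfolding U_def by (rule card_assigned_le[OF inv finX]) (use AX in auto)
  ultimately show "k \<le> 4 * xc + 2" using INT X(2) by simp
qed

section \<open>Assembly of the program and its running time\<close>

definition reduce :: prog where
  "reduce = load ;; cover ;; auction ;; relabel ;; output_rows ;; output_nt ;; output_adj ;; finish"

text \<open>The counters \<open>i\<close> and \<open>q\<close> are exempt in \<open>inp\<close>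
  because \<open>tables\<close> has used them; every loop resets its counter.\<close>

lemma run_reduce:
  assumes inst: "ntst_instance {..<n} E NT" and lim: "limits_ok n s"
    and inp: "\<And>x. x \<notin> {''m'', ''d'', ''L'', ''nn'', ''r'', ''row'', ''i'', ''q''} \<Longrightarrow> s x = encode n E NT x"
  shows "\<exists>n' E' NT'. represents (run reduce s) n' E' NT' \<and> ntst_instance {..<n'} E' NT' \<and>
    (ntst_yes {..<n'} E' NT' \<longleftrightarrow> ntst_yes {..<n} E NT) \<and> n' \<le> 8 * vc {..<n} E + 2"
proof -
  have ug: "ugraph {..<n} E" and NT: "NT \<subseteq> {..<n}" using inst by (auto simp: ntst_instance_def)
  have loop: "{i, i} \<notin> E" for i using ug by (auto simp: ugraph_def)
  define s1 where "s1 = run load s"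
  define s2 where "s2 = run cover s1"
  define s3 where "s3 = run auction s2"
  define s4 where "s4 = run relabel s3"
  define s5 where "s5 = run output_rows s4"
  define s6 where "s6 = run output_nt s5"
  define s7 where "s7 = run output_adj s6"
  \<comment> \<open>These frame equations carry each array from the phase that computes it to the
    phases that read it.\<close>
  have e1: "s1 x = s x" if "x \<notin> {''z'', ''g'', ''adj'', ''i'', ''t'', ''nt'', ''md''}" for x
    unfolding s1_def using that by (intro run_unwritten) (simp add: load_def)
  have e2: "s2 x = s1 x" if "x \<notin> {''i'', ''j'', ''c'', ''xc''}" for x
    unfolding s2_def using that by (intro run_unwritten) (simp add: cover_def cover_body_def)
  have e3: "s3 x = s2 x" if "x \<notin> {''z'', ''i'', ''q'', ''bp'', ''bq'', ''as'', ''sl'', ''p''}" for x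
    unfolding s3_def using that by (intro run_unwritten) (simp add: auction_def)
  have e4: "s4 x = s3 x" if "x \<notin> {''i'', ''rep'', ''f'', ''k''}" for x
    unfolding s4_def using that by (intro run_unwritten) (simp add: relabel_def)
  have e5: "s5 x = s4 x" if "x \<notin> {''i'', ''ro''}" for x
    unfolding s5_def using that by (intro run_unwritten) (simp add: output_rows_def)
  have e6: "s6 x = s5 x" if "x \<notin> {''i'', ''nt''}" for x
    unfolding s6_def using that by (intro run_unwritten) (simp add: output_nt_def)
  have e7: "s7 x = s6 x" if "x \<notin> {''i'', ''j'', ''adj''}" for x
    unfolding s7_def using that by (intro run_unwritten) (simp add: output_adj_def edge_body_def)
  have z: "s x = (\<lambda>_. 0)" if "x \<in> {''c'', ''xc'', ''p'', ''sl'', ''as'', ''k'', ''rep'', ''ro''}" for x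
    using that inp[of x] by (auto simp: encode_def)
  have adj: "s ''adj'' i = of_bool ({i div n, i mod n} \<in> E)"
    and nt: "s ''nt'' i = of_bool (i \<in> NT)" for i
    by (simp_all add: inp encode_def)
  note load = run_load[OF lim adj nt, folded s1_def]
  have l2: "loaded n E NT s2" unfolding s2_def
    using load(1) by (rule loaded_run) (auto simp: cover_def cover_body_def)
  have l3: "loaded n E NT s3" unfolding s3_def
    using l2 by (rule loaded_run) (auto simp: auction_def)
  have l4: "loaded n E NT s4" unfolding s4_def
    using l3 by (rule loaded_run) (auto simp: relabel_def)
  have l5: "loaded n E NT s5" unfolding s5_def
    using l4 by (rule loaded_run) (auto simp: output_rows_def)
  have l6: "loaded n E NT s6" unfolding s6_def
    using l5 by (rule loaded_run) (auto simp: output_nt_def)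
  have cov: "cover_inv E n (s2 ''c'') (s2 ''xc'' 0) ({..<n} \<times> {..<n})"
    unfolding s2_def by (rule run_cover[OF load(1) _ _ loop]) (simp_all add: e1 z)
  define I where "I = {v. v < n \<and> v \<notin> NT \<and> s2 ''c'' v = 0}"
  have auc: "auction_state n E I s3" "\<forall>i<n. settled n E I s3 i"
    unfolding s3_def by (rule run_auction[OF l2]; simp add: I_def e1 e2 z)+
  define U where "U = unassigned I (s3 ''as'')"
  define f where "f = s4 ''f''"
  define k where "k = s4 ''k'' 0"
  have rel: "relabel_inv U n f k (s4 ''rep'' 0)"
    unfolding f_def k_def s4_def
    by (rule run_relabel[OF l3]) (simp_all add: U_def unassigned_def I_def e1 e2 e3 z)
  have stable: "\<forall>i\<in>unassigned I (s3 ''as''). \<forall>q<2 * n. {i, q mod n} \<in> E \<longrightarrow> 2 * n < s3 ''p'' q"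
    using auc(2) by (auto simp: settled_def unassigned_def I_def)
  note K = kernel_correct[OF inst cov I_def auc(1)[unfolded auction_state_def] stable rel[unfolded U_def]]
  have fk: "f i < k" if "i < n" for i using rel that by (auto simp: relabel_inv_def)
  have eqs: "s5 ''k'' 0 = k" "s5 ''f'' = f" "s6 ''f'' = f" "s7 ''k'' 0 = k" "s7 ''xc'' 0 = s2 ''xc'' 0"
    "s6 ''ro'' = s5 ''ro''" "s7 ''nt'' = s6 ''nt''" "s6 ''adj'' = s1 ''adj''" "s5 ''nt'' = s1 ''nt''"
    by (simp_all add: e7 e6 e5 e4 e3 e2 f_def k_def)
  have ro: "\<forall>i\<le>n. s5 ''ro'' i = i * k"
    unfolding s5_def k_def by (rule run_output_rows[OF l4]) (simp add: e4 e3 e2 e1 z)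
  have "\<forall>a<n. s6 ''nt'' a = of_bool (a \<in> s5 ''f'' ` NT)"
    unfolding s6_def by (rule run_output_nt[OF l5 _ NT]) (simp add: eqs load)
  then have nt7: "s7 ''nt'' a = of_bool (a \<in> f ` NT)" if "a < k" for a
    using that K(3) by (simp add: eqs)
  have "\<forall>z<n * n. s7 ''adj'' z =
      of_bool (\<exists>(i, j)\<in>{..<n} \<times> {..<n}. {i, j} \<in> E \<and> z = s6 ''f'' i * k + s6 ''f'' j)"
    unfolding s7_def
    by (rule run_output_adj[OF l6]) (use load(2) fk K(3) ro in \<open>simp_all add: eqs\<close>)
  moreover have "k * k \<le> n * n" using K(3) by (intro mult_le_mono)
  ultimately have adj7: "s7 ''adj'' z =
      of_bool (\<exists>(i, j)\<in>{..<n} \<times> {..<n}. {i, j} \<in> E \<and> z = f i * k + f j)" if "z < k * k" for z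
    using that by (simp add: eqs)
  have run: "run reduce s = run finish s7"
    by (simp add: reduce_def s7_def s6_def s5_def s4_def s3_def s2_def s1_def)
  show ?thesis
  proof (cases "k \<le> 4 * s2 ''xc'' 0 + 2")
    case True
    have "represents (run finish s7) k ((`) f ` E) (f ` NT)"
      by (rule represents_relabelled[OF _ _ ug]) (use True fk adj7 nt7 in \<open>simp_all add: eqs\<close>)
    moreover have "k \<le> 8 * vc {..<n} E + 2" using True K(5) by simp
    ultimately show ?thesis unfolding run using K(1,2) by blast
  next
    case False
    \<comment> \<open>Only a no-instance can stay too large, so any fixed no-instance is equivalent
      to it.\<close>
    then have "\<not> ntst_yes {..<n} E NT" using K(4) by blast
    moreover have "represents (run finish s7) 3 path3 {0}"
      by (rule represents_no_instance) (use False in \<open>simp add: eqs\<close>)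
    moreover have "3 \<le> 8 * vc {..<n} E + 2" using K(6) by simp
    ultimately show ?thesis
      unfolding run using ntst_instance_path3 not_ntst_yes_path3 by blast
  qed
qed

lemma fresh_loops_reduce: "fresh_loops reduce" "writes reduce \<inter> limits reduce = {}"
    "limits reduce = {''m'', ''d'', ''nn'', ''r''}"
  by (auto simp: reduce_def load_def cover_def cover_body_def auction_def bid_def cheapest_def relabel_def
      output_rows_def output_nt_def output_adj_def edge_body_def finish_def)

theorem theorem3:
  shows "\<exists>(prog :: com) (p :: nat poly). \<forall>(n :: nat) (E :: nat set set) (NT :: nat set).
    ntst_instance {..<n} E NT \<longrightarrow>
    (\<exists>t s n' E' NT'.
       exec prog (encode n E NT) t s \<and> t \<le> poly p n \<and>
       represents s n' E' NT' \<and>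
       ntst_instance {..<n'} E' NT' \<and>
       (ntst_yes {..<n'} E' NT' \<longleftrightarrow> ntst_yes {..<n} E NT) \<and>
       n' \<le> 8 * vc {..<n} E + 2)"
proof -
  \<comment> \<open>A stage may not write the limits of its own loops, so these are computed by the
    stages before it, and each stage is timed separately.\<close>
  let ?prog = "Seq (code init) (Seq (code tables) (code reduce))"
  \<comment> \<open>The limits are at most \<open>2 * n\<close> in \<open>tables\<close> and at most
    the number \<open>1 + 2 * n + 4 * n * n\<close> of rounds in \<open>reduce\<close>;
    \<open>init\<close> has no loops and takes constant time.\<close>
  let ?p = "[:poly (cost init) 0:] + (cost tables \<circ>\<^sub>p [:0, 2:]) + (cost reduce \<circ>\<^sub>p [:1, 2, 4:])"
  show ?thesis
  proof (rule exI[of _ ?prog], rule exI[of _ ?p], intro allI impI)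
    fix n :: nat and E :: "nat set set" and NT :: "nat set"
    assume inst: "ntst_instance {..<n} E NT"
    define s0 where "s0 = encode n E NT"
    define s1 where "s1 = run init s0"
    define s2 where "s2 = run tables s1"
    have s1: "s1 x = s0 x" if "x \<notin> {''m'', ''d'', ''L''}" for x
      unfolding s1_def using that by (intro run_unwritten) (simp add: init_def)
    have s2: "s2 x = s1 x" if "x \<notin> {''i'', ''row'', ''nn'', ''r'', ''q''}" for x
      unfolding s2_def using that by (intro run_unwritten) (simp add: tables_def)
    have v1: "s1 ''m'' 0 = n" "s1 ''d'' 0 = 2 * n" "s1 ''L'' 0 = Suc (2 * n)" "s1 ''row'' 0 = 0"
      by (simp_all add: s1_def init_def s0_def encode_def)
    have lim: "limits_ok n s2" unfolding s2_def by (rule run_tables) (rule v1)+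
    have inp: "s2 x = encode n E NT x"
      if "x \<notin> {''m'', ''d'', ''L'', ''nn'', ''r'', ''row'', ''i'', ''q''}" for x
      using that s1[of x] s2[of x] by (simp add: s0_def)
    obtain n' E' NT' where out: "represents (run reduce s2) n' E' NT'" "ntst_instance {..<n'} E' NT'"
      "ntst_yes {..<n'} E' NT' \<longleftrightarrow> ntst_yes {..<n} E NT" "n' \<le> 8 * vc {..<n} E + 2"
      using run_reduce[OF inst lim inp] by blast
    obtain t0 where t0: "exec (code init) s0 t0 s1" "t0 \<le> poly (cost init) 0"
      using exec_code[of init s0 0] by (auto simp: s1_def init_def)
    have "\<exists>t. exec (code tables) s1 t (run tables s1) \<and> t \<le> poly (cost tables) (2 * n)"
      by (rule exec_code) (auto simp: tables_def v1)
    then obtain t1 where t1: "exec (code tables) s1 t1 s2" "t1 \<le> poly (cost tables) (2 * n)"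
      by (auto simp: s2_def)
    define M where "M = Suc (2 * n * Suc (2 * n))"
    have "\<exists>t. exec (code reduce) s2 t (run reduce s2) \<and> t \<le> poly (cost reduce) M"
    proof (rule exec_code)
      fix b assume "b \<in> limits reduce"
      moreover have "n * n \<le> M" "n \<le> M" "2 * n \<le> M" by (simp_all add: M_def)
      ultimately show "s2 b 0 \<le> M"
        using lim by (auto simp: fresh_loops_reduce limits_ok_def M_def)
    qed (rule fresh_loops_reduce)+
    then obtain t2 where t2: "exec (code reduce) s2 t2 (run reduce s2)" "t2 \<le> poly (cost reduce) M"
      by blast
    have "exec ?prog (encode n E NT) (t0 + (t1 + t2)) (run reduce s2)"
      using t0(1) t1(1) t2(1) by (intro exec.Seq) (simp_all add: s0_def)
    moreover have "t0 + (t1 + t2) \<le> poly ?p n"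
    proof -
      have "poly [:1, 2, 4:] n = M" by (simp add: M_def algebra_simps)
      moreover have "poly [:0, 2:] n = 2 * n" by simp
      ultimately have "poly ?p n = poly (cost init) 0 + poly (cost tables) (2 * n) + poly (cost reduce) M"
        by (simp only: poly_add poly_pcompose) simp
      then show ?thesis using t0(2) t1(2) t2(2) by simp
    qed
    ultimately show "\<exists>t s n' E' NT'.
         exec ?prog (encode n E NT) t s \<and> t \<le> poly ?p n \<and>
         represents s n' E' NT' \<and>
         ntst_instance {..<n'} E' NT' \<and>
         (ntst_yes {..<n'} E' NT' \<longleftrightarrow> ntst_yes {..<n} E NT) \<and>
         n' \<le> 8 * vc {..<n} E + 2"
      using out by (intro exI conjI)
  qed
qed

end
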